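(* Let $\Omega\subseteq\mathbb{C}$ be a non-void open set and let $f\in\mathcal{HG}(\Omega)$. If $f$ satisfies the Identity Theorem, then for all $z_0\in\widetilde{\Omega}_c$ the ideal $C_f(z_0)$ is a dense ideal of $\overline{\mathbb{C}}$, i.e. $C_f(z_0)\in D(\overline{\mathbb{C}})$.
   Context: Let $\mathbf{I}=\,]0,1]$. A function $\hat x:\mathbf{I}\to\mathbb{C}$ is moderate if there is $a\in\mathbb{R}$ with $\lim_{\varepsilon\to 0}|\hat x(\varepsilon)|/\varepsilon^{a}=0$, and null if this limit is $0$ for all $a\in\mathbb{R}$. $\overline{\mathbb{C}}$ (Colombeau generalized complex numbers) is the ring of moderate functions modulo the ideal of null functions. It carries the sharp topology, given by the ultrametric $D(x,y)=\|x-y\|$, where $\|x\|=e^{-V(x)}$ and $V(x)=\sup\{a\in\mathbb{R}:\lim_{\varepsilon\to0}|\hat x(\varepsilon)|/\varepsilon^a=0\}$ for any representative $\hat x$ of $x$ (with $e^{-\infty}=0$). $\mathcal{G}(\Omega;\mathbb{C})$ is the (simplified) Colombeau algebra: nets $(f_\varepsilon)_{\varepsilon\in\mathbf{I}}$ in $C^\infty(\Omega;\mathbb{C})$ such that for every compact $K\subset\Omega$ and every partial derivative $\partial^\alpha$ there is $N\in\mathbb{N}$ with $\sup_K|\partial^\alpha f_\varepsilon|=O(\varepsilon^{-N})$ as $\varepsilon\to0$, modulo those nets for which $\sup_K|\partial^\alpha f_\varepsilon|=O(\varepsilon^{m})$ for all compact $K$, all $\alpha$ and all $m\in\mathbb{N}$.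 Derivatives act on representatives. $\mathcal{HG}(\Omega)=\{f\in\mathcal{G}(\Omega;\mathbb{C}):\overline{\partial}f=0\}$ is the set of generalized holomorphic functions; $f^{(n)}$ denotes the $n$-th (complex) derivative of $f$. $\widetilde{\Omega}_c\subseteq\overline{\mathbb{C}}$ is the set of compactly supported generalized points: classes of nets $(z_\varepsilon)$ in $\Omega$ for which there is a compact $K\subset\Omega$ with $z_\varepsilon\in K$ for all small $\varepsilon$. An $f\in\mathcal{G}(\Omega;\mathbb{C})$ is viewed as a function $\widetilde{\Omega}_c\to\overline{\mathbb{C}}$ by $f([z_\varepsilon])=[f_\varepsilon(z_\varepsilon)]$; $\widetilde{\Omega}_c$ has the topology induced by the sharp topology. $f$ satisfies the Identity Theorem if for every $z_0\in\widetilde{\Omega}_c$ the pre-image $f^{-1}(f(z_0))\subseteq \widetilde{\Omega}_c$ has no accumulation point. $C_f(z_0)=\langle f^{(n)}(z_0) : n\in\mathbb{N},\ n\geq1\rangle$ is the ideal of $\overline{\mathbb{C}}$ generated by the values $f^{(n)}(z_0)$, $n\ge 1$. An ideal $J$ of a commutative ring $R$ is dense (in the algebraic sense), written $J\in D(R)$, if for all $r_1,r_2\in R$ with $r_1\neq0$ there is $r\in R$ with $r_1r\neq0$ and $r_2r\in J$. *)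

theory Defs
  imports "HOL-Analysis.Analysis" "HOL-Library.Landau_Symbols"
begin

section \<open>Colombeau generalized complex numbers\<close>

text \<open>
  A net indexed by \<open>I = ]0,1]\<close> is represented by a function on \<^typ>\<open>real\<close>; its values outside
  \<open>]0,1]\<close> are irrelevant, and the limit \<open>\<epsilon> \<rightarrow> 0\<close> in \<open>I\<close> is the limit along \<^term>\<open>at_right (0::real)\<close>.
\<close>

definition decays :: "(real \<Rightarrow> complex) \<Rightarrow> real \<Rightarrow> bool" where
  "decays x a \<longleftrightarrow> ((\<lambda>\<epsilon>. cmod (x \<epsilon>) / \<epsilon> powr a) \<longlongrightarrow> 0) (at_right 0)"

definition moderate :: "(real \<Rightarrow> complex) \<Rightarrow> bool" where
  "moderate x \<longleftrightarrow> (\<exists>a. decays x a)"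

definition null :: "(real \<Rightarrow> complex) \<Rightarrow> bool" where
  "null x \<longleftrightarrow> (\<forall>a. decays x a)"

lemma ev01: "\<forall>\<^sub>F \<epsilon> in at_right (0::real). 0 < \<epsilon> \<and> \<epsilon> \<le> 1"
  by (rule eventually_at_rightI[of 0 1]) auto

lemma decays_mono:
  assumes "decays x a" "b \<le> a"
  shows "decays x b"
  unfolding decays_def
proof (rule Lim_null_comparison)
  show "((\<lambda>\<epsilon>. cmod (x \<epsilon>) / \<epsilon> powr a) \<longlongrightarrow> 0) (at_right 0)"
    using assms(1) by (simp add: decays_def)
  show "\<forall>\<^sub>F \<epsilon> in at_right 0. norm (cmod (x \<epsilon>) / \<epsilon> powr b) \<le> cmod (x \<epsilon>) / \<epsilon> powr a"
    using ev01
  proof eventually_elim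
    case (elim \<epsilon>)
    then have "\<epsilon> powr a \<le> \<epsilon> powr b" using assms(2) by (intro powr_mono') auto
    then show ?case using elim by (auto intro!: divide_left_mono)
  qed
qed

lemma decays_zero [simp]: "decays (\<lambda>_. 0) a"
  by (simp add: decays_def)

lemma decays_one: "decays (\<lambda>_. 1) (-1)"
proof -
  have "((\<lambda>\<epsilon>::real. \<epsilon>) \<longlongrightarrow> 0) (at_right 0)" by (rule tendsto_ident_at)
  moreover have "\<forall>\<^sub>F \<epsilon> in at_right (0::real). \<epsilon> = cmod 1 / \<epsilon> powr (-1)"
    using ev01 by eventually_elim (simp add: powr_minus field_simps)
  ultimately show ?thesis unfolding decays_def by (rule Lim_transform_eventually)
qed

lemma not_null_one: "\<not> decays (\<lambda>_. 1) 0"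
proof
  assume "decays (\<lambda>_. 1) 0"
  then have "((\<lambda>\<epsilon>::real. cmod 1 / \<epsilon> powr 0) \<longlongrightarrow> 0) (at_right 0)" by (simp add: decays_def)
  moreover have "\<forall>\<^sub>F \<epsilon> in at_right (0::real). cmod 1 / \<epsilon> powr 0 = 1"
    using ev01 by eventually_elim simp
  ultimately have "((\<lambda>\<epsilon>::real. 1::real) \<longlongrightarrow> 0) (at_right 0)" by (rule Lim_transform_eventually)
  then show False by (simp add: tendsto_const_iff)
qed

lemma decays_uminus [simp]: "decays (\<lambda>\<epsilon>. - x \<epsilon>) a \<longleftrightarrow> decays x a"
  by (simp add: decays_def)

lemma decays_add:
  assumes "decays x a" "decays y a"
  shows "decays (\<lambda>\<epsilon>. x \<epsilon> + y \<epsilon>) a"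
  unfolding decays_def
proof (rule Lim_null_comparison)
  show "((\<lambda>\<epsilon>. cmod (x \<epsilon>) / \<epsilon> powr a + cmod (y \<epsilon>) / \<epsilon> powr a) \<longlongrightarrow> 0) (at_right 0)"
    using tendsto_add[OF assms[unfolded decays_def]] by simp
  show "\<forall>\<^sub>F \<epsilon> in at_right 0. norm (cmod (x \<epsilon> + y \<epsilon>) / \<epsilon> powr a)
      \<le> cmod (x \<epsilon>) / \<epsilon> powr a + cmod (y \<epsilon>) / \<epsilon> powr a"
    by (intro always_eventually allI)
       (auto simp: add_divide_distrib[symmetric] intro!: divide_right_mono norm_triangle_ineq)
qed

lemma decays_diff:
  assumes "decays x a" "decays y a"
  shows "decays (\<lambda>\<epsilon>. x \<epsilon> - y \<epsilon>) a"
  using decays_add[of x a "\<lambda>\<epsilon>. - y \<epsilon>"] assms by simp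

lemma decays_mult:
  assumes "decays x a" "decays y b"
  shows "decays (\<lambda>\<epsilon>. x \<epsilon> * y \<epsilon>) (a + b)"
  using tendsto_mult[OF assms[unfolded decays_def]]
  by (simp add: decays_def norm_mult powr_add)

lemma decays_cong:
  assumes "null (\<lambda>\<epsilon>. x \<epsilon> - y \<epsilon>)"
  shows "decays x a \<longleftrightarrow> decays y a"
proof
  assume "decays x a"
  from decays_diff[OF this, of "\<lambda>\<epsilon>. x \<epsilon> - y \<epsilon>"] assms show "decays y a"
    by (simp add: null_def)
next
  assume "decays y a"
  from decays_add[OF this, of "\<lambda>\<epsilon>. x \<epsilon> - y \<epsilon>"] assms show "decays x a"
    by (simp add: null_def)
qed

lemma null_moderate: "null x \<Longrightarrow> moderate x"
  by (auto simp: null_def moderate_def)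

lemma null_add: "null x \<Longrightarrow> null y \<Longrightarrow> null (\<lambda>\<epsilon>. x \<epsilon> + y \<epsilon>)"
  by (simp add: null_def decays_add)

lemma null_uminus: "null x \<Longrightarrow> null (\<lambda>\<epsilon>. - x \<epsilon>)"
  by (simp add: null_def)

lemma null_mult:
  assumes "moderate x" "null y"
  shows "null (\<lambda>\<epsilon>. x \<epsilon> * y \<epsilon>)"
  unfolding null_def
proof
  fix a
  obtain b where "decays x b" using assms(1) by (auto simp: moderate_def)
  from decays_mult[OF this, of y "a - b"] assms(2) show "decays (\<lambda>\<epsilon>. x \<epsilon> * y \<epsilon>) a"
    by (simp add: null_def)
qed

lemma moderate_uminus: "moderate x \<Longrightarrow> moderate (\<lambda>\<epsilon>. - x \<epsilon>)"
  by (simp add: moderate_def)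

lemma moderate_add:
  assumes "moderate x" "moderate y"
  shows "moderate (\<lambda>\<epsilon>. x \<epsilon> + y \<epsilon>)"
proof -
  obtain a b where "decays x a" "decays y b" using assms by (auto simp: moderate_def)
  then have "decays (\<lambda>\<epsilon>. x \<epsilon> + y \<epsilon>) (min a b)"
    by (intro decays_add) (auto intro: decays_mono)
  then show ?thesis by (auto simp: moderate_def)
qed

lemma moderate_mult: "moderate x \<Longrightarrow> moderate y \<Longrightarrow> moderate (\<lambda>\<epsilon>. x \<epsilon> * y \<epsilon>)"
  unfolding moderate_def using decays_mult by blast

definition gc_rel :: "(real \<Rightarrow> complex) \<Rightarrow> (real \<Rightarrow> complex) \<Rightarrow> bool" where
  "gc_rel x y \<longleftrightarrow> moderate x \<and> moderate y \<and> null (\<lambda>\<epsilon>. x \<epsilon> - y \<epsilon>)"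

lemma gc_rel_refl: "moderate x \<Longrightarrow> gc_rel x x"
  by (simp add: gc_rel_def null_def)

quotient_type gcomplex = "real \<Rightarrow> complex" / partial: gc_rel
proof (rule part_equivpI)
  show "\<exists>x. gc_rel x x"
    by (rule exI[of _ "\<lambda>_. 0"], rule gc_rel_refl) (auto simp: moderate_def)
  show "symp gc_rel"
  proof (rule sympI)
    fix x y assume "gc_rel x y"
    then show "gc_rel y x"
      using null_uminus[of "\<lambda>\<epsilon>. x \<epsilon> - y \<epsilon>"] by (simp add: gc_rel_def)
  qed
  show "transp gc_rel"
  proof (rule transpI)
    fix x y z assume "gc_rel x y" "gc_rel y z"
    then show "gc_rel x z"
      using null_add[of "\<lambda>\<epsilon>. x \<epsilon> - y \<epsilon>" "\<lambda>\<epsilon>. y \<epsilon> - z \<epsilon>"] by (simp add: gc_rel_def)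
  qed
qed

instantiation gcomplex :: comm_ring_1
begin

lift_definition zero_gcomplex :: gcomplex is "\<lambda>_. 0"
  by (rule gc_rel_refl) (auto simp: moderate_def)

lift_definition one_gcomplex :: gcomplex is "\<lambda>_. 1"
  by (rule gc_rel_refl) (use decays_one in \<open>auto simp: moderate_def\<close>)

lift_definition uminus_gcomplex :: "gcomplex \<Rightarrow> gcomplex" is "\<lambda>x \<epsilon>. - x \<epsilon>"
proof -
  fix x y assume "gc_rel x y"
  then show "gc_rel (\<lambda>\<epsilon>. - x \<epsilon>) (\<lambda>\<epsilon>. - y \<epsilon>)"
    using null_uminus[of "\<lambda>\<epsilon>. x \<epsilon> - y \<epsilon>"] by (simp add: gc_rel_def moderate_uminus)
qed

lift_definition plus_gcomplex :: "gcomplex \<Rightarrow> gcomplex \<Rightarrow> gcomplex" is "\<lambda>x y \<epsilon>. x \<epsilon> + y \<epsilon>"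
proof -
  fix x x' y y' assume *: "gc_rel x x'" "gc_rel y y'"
  then have "null (\<lambda>\<epsilon>. (x \<epsilon> - x' \<epsilon>) + (y \<epsilon> - y' \<epsilon>))"
    by (intro null_add) (auto simp: gc_rel_def)
  then show "gc_rel (\<lambda>\<epsilon>. x \<epsilon> + y \<epsilon>) (\<lambda>\<epsilon>. x' \<epsilon> + y' \<epsilon>)"
    using * by (simp add: gc_rel_def moderate_add algebra_simps)
qed

definition minus_gcomplex :: "gcomplex \<Rightarrow> gcomplex \<Rightarrow> gcomplex" where
  "minus_gcomplex x y = x + (- y)"

lift_definition times_gcomplex :: "gcomplex \<Rightarrow> gcomplex \<Rightarrow> gcomplex" is "\<lambda>x y \<epsilon>. x \<epsilon> * y \<epsilon>"
proof -
  fix x x' y y' assume *: "gc_rel x x'" "gc_rel y y'"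
  then have "null (\<lambda>\<epsilon>. x \<epsilon> * (y \<epsilon> - y' \<epsilon>) + y' \<epsilon> * (x \<epsilon> - x' \<epsilon>))"
    by (intro null_add null_mult) (auto simp: gc_rel_def)
  then show "gc_rel (\<lambda>\<epsilon>. x \<epsilon> * y \<epsilon>) (\<lambda>\<epsilon>. x' \<epsilon> * y' \<epsilon>)"
    using * by (simp add: gc_rel_def moderate_mult algebra_simps)
qed

instance
proof
  fix a b c :: gcomplex
  show "a * b * c = a * (b * c)"
    by transfer (auto simp: gc_rel_def null_def moderate_mult algebra_simps)
  show "a * b = b * a"
    by transfer (auto simp: gc_rel_def null_def moderate_mult algebra_simps)
  show "1 * a = a"
    by transfer (auto simp: gc_rel_def null_def)
  show "a + b + c = a + (b + c)"
    by transfer (auto simp: gc_rel_def null_def moderate_add algebra_simps)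
  show "a + b = b + a"
    by transfer (auto simp: gc_rel_def null_def moderate_add algebra_simps)
  show "0 + a = a"
    by transfer (auto simp: gc_rel_def null_def)
  show "- a + a = 0"
    by transfer (auto simp: gc_rel_def null_def moderate_def intro: exI[of _ 0])
  show "a - b = a + - b"
    by (simp add: minus_gcomplex_def)
  show "(a + b) * c = a * c + b * c"
    by transfer (auto simp: gc_rel_def null_def moderate_mult moderate_add algebra_simps)
  show "(0::gcomplex) \<noteq> 1"
    by transfer (use not_null_one decays_uminus[of "\<lambda>_. 1" 0] in \<open>auto simp: gc_rel_def null_def\<close>)
qed

end

lift_definition valuation :: "gcomplex \<Rightarrow> ereal" is "\<lambda>x. Sup (ereal ` {a. decays x a})"
proof -
  fix x y assume "gc_rel x y"
  then have "decays x a \<longleftrightarrow> decays y a" for a by (intro decays_cong) (simp add: gc_rel_def)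
  then show "Sup (ereal ` {a. decays x a}) = Sup (ereal ` {a. decays y a})" by simp
qed

text \<open>The value \<open>\<infinity>\<close> of the valuation is treated separately because \<^term>\<open>exp\<close> lives on the reals;
  the value \<open>-\<infinity>\<close> does not occur (lemma \<open>valuation_not_minus_infinity\<close>).\<close>

definition sharp_norm :: "gcomplex \<Rightarrow> real" where
  "sharp_norm x = (if valuation x = \<infinity> then 0 else exp (- real_of_ereal (valuation x)))"

lemma valuation_not_minus_infinity: "valuation x \<noteq> -\<infinity>"
proof -
  have "\<exists>a. ereal a \<le> valuation x"
    by transfer (auto simp: gc_rel_def moderate_def intro: Sup_upper)
  then show ?thesis by (metis MInfty_neq_ereal(1) ereal_infty_less_eq(2))
qed

lemma valuation_infinity_iff: "valuation x = \<infinity> \<longleftrightarrow> x = 0"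
proof transfer
  fix x assume x: "gc_rel x x"
  have "gc_rel x (\<lambda>_. 0) \<longleftrightarrow> null x"
    using x by (auto simp: gc_rel_def moderate_def intro: exI[of _ 0])
  moreover have "Sup (ereal ` {a. decays x a}) = \<infinity> \<longleftrightarrow> null x"
  proof
    assume *: "Sup (ereal ` {a. decays x a}) = \<infinity>"
    show "null x" unfolding null_def
    proof
      fix a
      have "ereal a < Sup (ereal ` {a. decays x a})" by (simp add: *)
      then obtain b where "decays x b" "a < b" by (auto simp: less_Sup_iff)
      then show "decays x a" by (auto intro: decays_mono)
    qed
  next
    assume "null x"
    then have "{a. decays x a} = UNIV" by (auto simp: null_def)
    then have "ereal b \<le> Sup (ereal ` {a. decays x a})" for b
      by (intro Sup_upper) simp
    then show "Sup (ereal ` {a. decays x a}) = \<infinity>"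
      by (rule ereal_top)
  qed
  ultimately show "Sup (ereal ` {a. decays x a}) = \<infinity> \<longleftrightarrow> gc_rel x (\<lambda>_. 0)" by simp
qed

lemma valuation_uminus: "valuation (- x) = valuation x"
proof transfer
  fix x :: "real \<Rightarrow> complex"
  have "decays (\<lambda>\<epsilon>. - x \<epsilon>) = decays x"
    by (rule ext) (rule decays_uminus)
  then show "Sup (ereal ` {a. decays (\<lambda>\<epsilon>. - x \<epsilon>) a}) = Sup (ereal ` {a. decays x a})"
    by (rule arg_cong)
qed

lemma valuation_add: "min (valuation x) (valuation y) \<le> valuation (x + y)"
proof transfer
  fix x y assume "gc_rel x x" "gc_rel y y"
  show "min (Sup (ereal ` {a. decays x a})) (Sup (ereal ` {a. decays y a}))
      \<le> Sup (ereal ` {a. decays (\<lambda>\<epsilon>. x \<epsilon> + y \<epsilon>) a})"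
  proof (rule dense_le)
    fix c :: ereal
    assume "c < min (Sup (ereal ` {a. decays x a})) (Sup (ereal ` {a. decays y a}))"
    then obtain a b where ab: "decays x a" "c < ereal a" "decays y b" "c < ereal b"
      by (auto simp: less_Sup_iff)
    then have "decays (\<lambda>\<epsilon>. x \<epsilon> + y \<epsilon>) (min a b)"
      by (intro decays_add) (auto intro: decays_mono)
    then have "ereal (min a b) \<le> Sup (ereal ` {a. decays (\<lambda>\<epsilon>. x \<epsilon> + y \<epsilon>) a})"
      by (intro Sup_upper imageI) simp
    moreover have "c \<le> ereal (min a b)" using ab by (auto simp: min_def)
    ultimately show "c \<le> Sup (ereal ` {a. decays (\<lambda>\<epsilon>. x \<epsilon> + y \<epsilon>) a})" by (rule order_trans[rotated])
  qed
qed

lemma sharp_norm_antimono: "valuation x \<le> valuation y \<Longrightarrow> sharp_norm y \<le> sharp_norm x"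
  using valuation_not_minus_infinity[of x] valuation_not_minus_infinity[of y]
  by (cases "valuation x"; cases "valuation y") (auto simp: sharp_norm_def)

lemma sharp_norm_ultra: "sharp_norm (x + y) \<le> max (sharp_norm x) (sharp_norm y)"
  using valuation_add[of x y]
  by (auto simp: min_def split: if_splits dest!: sharp_norm_antimono)

lemma sharp_norm_nonneg: "0 \<le> sharp_norm x"
  by (simp add: sharp_norm_def)

lemma sharp_norm_eq_0: "sharp_norm x = 0 \<longleftrightarrow> x = 0"
  by (simp add: sharp_norm_def valuation_infinity_iff)

instantiation gcomplex :: metric_space
begin

definition dist_gcomplex :: "gcomplex \<Rightarrow> gcomplex \<Rightarrow> real" where
  "dist_gcomplex x y = sharp_norm (x - y)"

definition uniformity_gcomplex :: "(gcomplex \<times> gcomplex) filter" where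
  "uniformity_gcomplex = (INF e\<in>{0<..}. principal {(x, y). dist x y < e})"

definition open_gcomplex :: "gcomplex set \<Rightarrow> bool" where
  "open_gcomplex S = (\<forall>x\<in>S. \<forall>\<^sub>F (x', y) in uniformity. x' = x \<longrightarrow> y \<in> S)"

instance
proof
  fix x y z :: gcomplex
  show "dist x y = 0 \<longleftrightarrow> x = y"
    by (simp add: dist_gcomplex_def sharp_norm_eq_0)
  have "sharp_norm (y - z) = sharp_norm (z - y)"
    using valuation_uminus[of "y - z"] by (simp add: sharp_norm_def)
  then show "dist x y \<le> dist x z + dist y z"
    using sharp_norm_ultra[of "x - z" "z - y"] sharp_norm_nonneg[of "x - z"] sharp_norm_nonneg[of "z - y"]
    by (simp add: dist_gcomplex_def)
qed (simp_all add: uniformity_gcomplex_def open_gcomplex_def)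

end

section \<open>The simplified Colombeau algebra\<close>

text \<open>\<^term>\<open>pderiv_dir 1\<close> and \<^term>\<open>pderiv_dir \<i>\<close> are the partial derivatives with respect to the real
  and the imaginary part. A word over \<open>{1, \<i>}\<close> encodes an iterated partial derivative.\<close>

definition pderiv_dir :: "complex \<Rightarrow> (complex \<Rightarrow> complex) \<Rightarrow> complex \<Rightarrow> complex" where
  "pderiv_dir v g z = frechet_derivative g (at z) v"

abbreviation partial_deriv :: "complex list \<Rightarrow> (complex \<Rightarrow> complex) \<Rightarrow> complex \<Rightarrow> complex" where
  "partial_deriv \<alpha> g \<equiv> foldr pderiv_dir \<alpha> g"

definition smooth_on :: "complex set \<Rightarrow> (complex \<Rightarrow> complex) \<Rightarrow> bool" where
  "smooth_on \<Omega> g \<longleftrightarrow> (\<forall>\<alpha>\<in>lists {1, \<i>}. \<forall>z\<in>\<Omega>. partial_deriv \<alpha> g differentiable (at z))"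

text \<open>In the two estimates the trivial case \<open>K = {}\<close> is left out because the supremum of the empty
  set of reals is unspecified.\<close>

definition colombeau_moderate :: "complex set \<Rightarrow> (real \<Rightarrow> complex \<Rightarrow> complex) set" where
  "colombeau_moderate \<Omega> = {u. (\<forall>\<epsilon>\<in>{0<..1}. smooth_on \<Omega> (u \<epsilon>)) \<and>
     (\<forall>K \<alpha>. compact K \<and> K \<noteq> {} \<and> K \<subseteq> \<Omega> \<and> \<alpha> \<in> lists {1, \<i>} \<longrightarrow>
       (\<exists>N::nat. (\<lambda>\<epsilon>. SUP z\<in>K. cmod (partial_deriv \<alpha> (u \<epsilon>) z)) \<in> O[at_right 0](\<lambda>\<epsilon>. 1 / \<epsilon> ^ N)))}"

definition colombeau_null :: "complex set \<Rightarrow> (real \<Rightarrow> complex \<Rightarrow> complex) set" where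
  "colombeau_null \<Omega> = {u. (\<forall>\<epsilon>\<in>{0<..1}. smooth_on \<Omega> (u \<epsilon>)) \<and>
     (\<forall>K \<alpha>. compact K \<and> K \<noteq> {} \<and> K \<subseteq> \<Omega> \<and> \<alpha> \<in> lists {1, \<i>} \<longrightarrow>
       (\<forall>m::nat. (\<lambda>\<epsilon>. SUP z\<in>K. cmod (partial_deriv \<alpha> (u \<epsilon>) z)) \<in> O[at_right 0](\<lambda>\<epsilon>. \<epsilon> ^ m)))}"

definition colombeau_rel :: "complex set \<Rightarrow> (real \<Rightarrow> complex \<Rightarrow> complex) rel" where
  "colombeau_rel \<Omega> = {(u, v). u \<in> colombeau_moderate \<Omega> \<and> v \<in> colombeau_moderate \<Omega> \<and>
     (\<lambda>\<epsilon> z. u \<epsilon> z - v \<epsilon> z) \<in> colombeau_null \<Omega>}"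

type_synonym gfun = "(real \<Rightarrow> complex \<Rightarrow> complex) set"

definition colombeau :: "complex set \<Rightarrow> gfun set" where
  "colombeau \<Omega> = colombeau_moderate \<Omega> // colombeau_rel \<Omega>"

definition gfun_class :: "complex set \<Rightarrow> (real \<Rightarrow> complex \<Rightarrow> complex) \<Rightarrow> gfun" where
  "gfun_class \<Omega> u = colombeau_rel \<Omega> `` {u}"

definition gfun_lift ::
    "complex set \<Rightarrow> ((complex \<Rightarrow> complex) \<Rightarrow> complex \<Rightarrow> complex) \<Rightarrow> gfun \<Rightarrow> gfun" where
  "gfun_lift \<Omega> D f = (\<Union>u\<in>f. gfun_class \<Omega> (\<lambda>\<epsilon>. D (u \<epsilon>)))"

definition dbar :: "(complex \<Rightarrow> complex) \<Rightarrow> complex \<Rightarrow> complex" where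
  "dbar g z = (pderiv_dir 1 g z + \<i> * pderiv_dir \<i> g z) / 2"

definition dz :: "(complex \<Rightarrow> complex) \<Rightarrow> complex \<Rightarrow> complex" where
  "dz g z = (pderiv_dir 1 g z - \<i> * pderiv_dir \<i> g z) / 2"

definition gen_holomorphic :: "complex set \<Rightarrow> gfun set" where
  "gen_holomorphic \<Omega> = {f \<in> colombeau \<Omega>. gfun_lift \<Omega> dbar f = gfun_class \<Omega> (\<lambda>\<epsilon> z. 0)}"

text \<open>A representative of a generalized holomorphic function need not be holomorphic, so the complex
  derivative acts on representatives as the Wirtinger derivative \<open>\<partial>/\<partial>z\<close>.\<close>

definition gfun_deriv :: "complex set \<Rightarrow> nat \<Rightarrow> gfun \<Rightarrow> gfun" where
  "gfun_deriv \<Omega> n = gfun_lift \<Omega> dz ^^ n"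

subsection \<open>The operations do not depend on representatives\<close>

lemma pderiv_dir_cong:
  assumes "open \<Omega>" "z \<in> \<Omega>" "\<And>w. w \<in> \<Omega> \<Longrightarrow> g w = h w"
  shows "pderiv_dir v g z = pderiv_dir v h z"
proof -
  have "(g has_derivative f') (at z) \<longleftrightarrow> (h has_derivative f') (at z)" for f'
    using has_derivative_transform_within_open[of g f' z UNIV \<Omega> h]
      has_derivative_transform_within_open[of h f' z UNIV \<Omega> g] assms by auto
  then show ?thesis by (simp add: pderiv_dir_def frechet_derivative_def)
qed

lemma partial_deriv_cong:
  assumes "open \<Omega>" "\<And>w. w \<in> \<Omega> \<Longrightarrow> g w = h w"
  shows "z \<in> \<Omega> \<Longrightarrow> partial_deriv \<alpha> g z = partial_deriv \<alpha> h z"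
proof (induction \<alpha> arbitrary: z)
  case (Cons v \<alpha>)
  have "pderiv_dir v (partial_deriv \<alpha> g) z = pderiv_dir v (partial_deriv \<alpha> h) z"
    by (rule pderiv_dir_cong[OF assms(1) Cons.prems Cons.IH])
  then show ?case by simp
qed (simp add: assms(2))

lemma differentiable_cong_open:
  assumes "open \<Omega>" "z \<in> \<Omega>" "\<And>w. w \<in> \<Omega> \<Longrightarrow> g w = h w" "g differentiable (at z)"
  shows "h differentiable (at z)"
  using assms has_derivative_transform_within_open[of g _ z UNIV \<Omega> h]
  unfolding differentiable_def by blast

lemma smooth_on_cong:
  assumes "open \<Omega>" "\<And>w. w \<in> \<Omega> \<Longrightarrow> g w = h w" "smooth_on \<Omega> g"
  shows "smooth_on \<Omega> h"
  unfolding smooth_on_def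
proof (intro ballI)
  fix \<alpha> z assume "\<alpha> \<in> lists {1, \<i>}" "z \<in> \<Omega>"
  then have "partial_deriv \<alpha> g differentiable (at z)"
    using assms(3) by (simp add: smooth_on_def)
  with \<open>z \<in> \<Omega>\<close> show "partial_deriv \<alpha> h differentiable (at z)"
    by (intro differentiable_cong_open[OF assms(1) _ partial_deriv_cong[OF assms(1,2)]])
qed

lemma smooth_on_pderiv:
  assumes "smooth_on \<Omega> g" "v \<in> {1, \<i>}"
  shows "smooth_on \<Omega> (pderiv_dir v g)"
  unfolding smooth_on_def
proof (intro ballI)
  fix \<alpha> z assume "\<alpha> \<in> lists {1, \<i>}" "z \<in> \<Omega>"
  then have "\<alpha> @ [v] \<in> lists {1, \<i>}" using assms(2) by auto
  then have "partial_deriv (\<alpha> @ [v]) g differentiable (at z)"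
    using assms(1) \<open>z \<in> \<Omega>\<close> unfolding smooth_on_def by blast
  then show "partial_deriv \<alpha> (pderiv_dir v g) differentiable (at z)" by simp
qed

lemma partial_deriv_lincomb:
  assumes "open \<Omega>" "smooth_on \<Omega> g" "smooth_on \<Omega> h"
  shows "\<alpha> \<in> lists {1, \<i>} \<Longrightarrow> z \<in> \<Omega> \<Longrightarrow>
    partial_deriv \<alpha> (\<lambda>z. a * g z + b * h z) z = a * partial_deriv \<alpha> g z + b * partial_deriv \<alpha> h z"
proof (induction \<alpha> arbitrary: z)
  case (Cons v \<alpha>)
  have d: "partial_deriv \<alpha> g differentiable (at z)" "partial_deriv \<alpha> h differentiable (at z)"
    using Cons.prems assms by (auto simp: smooth_on_def)
  have "((\<lambda>z. a * partial_deriv \<alpha> g z + b * partial_deriv \<alpha> h z) has_derivative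
      (\<lambda>v. a * frechet_derivative (partial_deriv \<alpha> g) (at z) v
         + b * frechet_derivative (partial_deriv \<alpha> h) (at z) v)) (at z)"
    using d by (auto intro!: derivative_eq_intros simp: frechet_derivative_works)
  from frechet_derivative_at[OF this]
  have "pderiv_dir v (\<lambda>z. a * partial_deriv \<alpha> g z + b * partial_deriv \<alpha> h z) z
      = a * partial_deriv (v # \<alpha>) g z + b * partial_deriv (v # \<alpha>) h z"
    by (simp add: pderiv_dir_def fun_eq_iff)
  moreover have "partial_deriv (v # \<alpha>) (\<lambda>z. a * g z + b * h z) z
      = pderiv_dir v (\<lambda>z. a * partial_deriv \<alpha> g z + b * partial_deriv \<alpha> h z) z"
    using Cons by (simp, intro pderiv_dir_cong[OF assms(1)]) auto
  ultimately show ?case by simp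
qed simp

lemma smooth_on_lincomb:
  assumes "open \<Omega>" "smooth_on \<Omega> g" "smooth_on \<Omega> h"
  shows "smooth_on \<Omega> (\<lambda>z. a * g z + b * h z)"
  unfolding smooth_on_def
proof (intro ballI)
  fix \<alpha> z assume *: "\<alpha> \<in> lists {1, \<i>}" "z \<in> \<Omega>"
  have "(\<lambda>z. a * partial_deriv \<alpha> g z + b * partial_deriv \<alpha> h z) differentiable (at z)"
    using * assms(2,3) unfolding smooth_on_def
    by (intro differentiable_add differentiable_mult differentiable_const) auto
  then show "partial_deriv \<alpha> (\<lambda>z. a * g z + b * h z) differentiable (at z)"
    by (intro differentiable_cong_open[OF assms(1) *(2) partial_deriv_lincomb[OF assms *(1), symmetric]])
qed

lemma partial_deriv_zero: "partial_deriv \<alpha> (\<lambda>z. 0) = (\<lambda>z. 0)"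
proof (induction \<alpha>)
  case (Cons v \<alpha>)
  have "pderiv_dir v (\<lambda>z. 0) = (\<lambda>z. 0)" by (rule ext) (simp add: pderiv_dir_def)
  with Cons show ?case by simp
qed simp

lemma smooth_on_zero: "smooth_on \<Omega> (\<lambda>z. 0)"
  by (simp add: smooth_on_def partial_deriv_zero)

lemma SUP_bigo_iff:
  assumes "\<forall>\<epsilon>\<in>{0<..1}. smooth_on \<Omega> (u \<epsilon>)" "compact K" "K \<noteq> {}" "K \<subseteq> \<Omega>" "\<alpha> \<in> lists {1, \<i>}"
  shows "(\<lambda>\<epsilon>. SUP z\<in>K. cmod (partial_deriv \<alpha> (u \<epsilon>) z)) \<in> O[at_right 0](h :: real \<Rightarrow> real) \<longleftrightarrow>
    (\<exists>C. \<forall>\<^sub>F \<epsilon> in at_right 0. \<forall>z\<in>K. cmod (partial_deriv \<alpha> (u \<epsilon>) z) \<le> C * norm (h \<epsilon>))"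
    (is "?L \<longleftrightarrow> ?R")
proof
  have up: "cmod (partial_deriv \<alpha> (u \<epsilon>) z) \<le> norm (SUP z\<in>K. cmod (partial_deriv \<alpha> (u \<epsilon>) z))"
    if "0 < \<epsilon> \<and> \<epsilon> \<le> 1" "z \<in> K" for \<epsilon> z
  proof -
    have "partial_deriv \<alpha> (u \<epsilon>) differentiable (at x)" if "x \<in> K" for x
      using assms(1,4,5) \<open>0 < \<epsilon> \<and> \<epsilon> \<le> 1\<close> that unfolding smooth_on_def by (meson greaterThanAtMost_iff subsetD)
    then have "continuous_on K (partial_deriv \<alpha> (u \<epsilon>))"
      by (intro continuous_at_imp_continuous_on ballI differentiable_imp_continuous_within)
    then have "bdd_above ((\<lambda>z. cmod (partial_deriv \<alpha> (u \<epsilon>) z)) ` K)"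
      by (intro bounded_imp_bdd_above compact_imp_bounded compact_continuous_image
          continuous_intros assms)
    then show ?thesis using that by (auto intro!: cSUP_upper order_trans[OF _ abs_ge_self])
  qed
  {
    assume ?L
    then obtain c where "\<forall>\<^sub>F \<epsilon> in at_right 0.
        norm (SUP z\<in>K. cmod (partial_deriv \<alpha> (u \<epsilon>) z)) \<le> c * norm (h \<epsilon>)"
      by (rule landau_o.bigE)
    with ev01 have "\<forall>\<^sub>F \<epsilon> in at_right 0. \<forall>z\<in>K. cmod (partial_deriv \<alpha> (u \<epsilon>) z) \<le> c * norm (h \<epsilon>)"
      by eventually_elim (use up in \<open>meson order_trans\<close>)
    then show ?R by blast
  next
    assume ?R
    then obtain C where "\<forall>\<^sub>F \<epsilon> in at_right 0. \<forall>z\<in>K. cmod (partial_deriv \<alpha> (u \<epsilon>) z) \<le> C * norm (h \<epsilon>)"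
      by blast
    with ev01 have "\<forall>\<^sub>F \<epsilon> in at_right 0. norm (SUP z\<in>K. cmod (partial_deriv \<alpha> (u \<epsilon>) z)) \<le> C * norm (h \<epsilon>)"
    proof eventually_elim
      case (elim \<epsilon>)
      have le: "(SUP z\<in>K. cmod (partial_deriv \<alpha> (u \<epsilon>) z)) \<le> C * norm (h \<epsilon>)"
        using elim assms by (intro cSUP_least) auto
      obtain z where "z \<in> K" using assms by auto
      have "bdd_above ((\<lambda>z. cmod (partial_deriv \<alpha> (u \<epsilon>) z)) ` K)"
        using elim by (intro bdd_aboveI2) auto
      then have "0 \<le> (SUP z\<in>K. cmod (partial_deriv \<alpha> (u \<epsilon>) z))"
        by (intro cSUP_upper2[OF _ \<open>z \<in> K\<close>]) auto
      then show ?case using le by simp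
    qed
    then show ?L by (rule bigoI)
  }
qed

lemma colombeau_moderate_iff:
  "u \<in> colombeau_moderate \<Omega> \<longleftrightarrow> (\<forall>\<epsilon>\<in>{0<..1}. smooth_on \<Omega> (u \<epsilon>)) \<and>
    (\<forall>K \<alpha>. compact K \<and> K \<noteq> {} \<and> K \<subseteq> \<Omega> \<and> \<alpha> \<in> lists {1, \<i>} \<longrightarrow>
      (\<exists>N::nat. \<exists>C. \<forall>\<^sub>F \<epsilon> in at_right 0. \<forall>z\<in>K. cmod (partial_deriv \<alpha> (u \<epsilon>) z) \<le> C * norm (1 / \<epsilon> ^ N)))"
  unfolding colombeau_moderate_def mem_Collect_eq
  by (intro conj_cong refl all_cong1 imp_cong ex_cong1 SUP_bigo_iff) auto

lemma colombeau_null_iff: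
  "u \<in> colombeau_null \<Omega> \<longleftrightarrow> (\<forall>\<epsilon>\<in>{0<..1}. smooth_on \<Omega> (u \<epsilon>)) \<and>
    (\<forall>K \<alpha>. compact K \<and> K \<noteq> {} \<and> K \<subseteq> \<Omega> \<and> \<alpha> \<in> lists {1, \<i>} \<longrightarrow>
      (\<forall>m::nat. \<exists>C. \<forall>\<^sub>F \<epsilon> in at_right 0. \<forall>z\<in>K. cmod (partial_deriv \<alpha> (u \<epsilon>) z) \<le> C * norm (\<epsilon> ^ m)))"
  unfolding colombeau_null_def mem_Collect_eq
  by (intro conj_cong refl all_cong1 imp_cong SUP_bigo_iff) auto

lemma colombeau_moderate_smooth:
  "u \<in> colombeau_moderate \<Omega> \<Longrightarrow> \<epsilon> \<in> {0<..1} \<Longrightarrow> smooth_on \<Omega> (u \<epsilon>)"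
  unfolding colombeau_moderate_def by blast

lemma colombeau_null_smooth:
  "u \<in> colombeau_null \<Omega> \<Longrightarrow> \<epsilon> \<in> {0<..1} \<Longrightarrow> smooth_on \<Omega> (u \<epsilon>)"
  unfolding colombeau_null_def by blast

lemma colombeau_moderate_bound:
  assumes "u \<in> colombeau_moderate \<Omega>" "compact K \<and> K \<noteq> {} \<and> K \<subseteq> \<Omega> \<and> \<alpha> \<in> lists {1, \<i>}"
  shows "\<exists>N::nat. \<exists>C. \<forall>\<^sub>F \<epsilon> in at_right 0. \<forall>z\<in>K. cmod (partial_deriv \<alpha> (u \<epsilon>) z) \<le> C * norm (1 / \<epsilon> ^ N)"
  using assms(1)[unfolded colombeau_moderate_iff, THEN conjunct2, rule_format, OF assms(2)] .

lemma colombeau_null_bound: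
  assumes "u \<in> colombeau_null \<Omega>" "compact K \<and> K \<noteq> {} \<and> K \<subseteq> \<Omega> \<and> \<alpha> \<in> lists {1, \<i>}"
  shows "\<exists>C. \<forall>\<^sub>F \<epsilon> in at_right 0. \<forall>z\<in>K. cmod (partial_deriv \<alpha> (u \<epsilon>) z) \<le> C * norm (\<epsilon> ^ m)"
  using assms(1)[unfolded colombeau_null_iff, THEN conjunct2, rule_format, OF assms(2)] .

lemma estimate_lincomb:
  fixes u v :: "real \<Rightarrow> complex \<Rightarrow> complex" and h k l :: "real \<Rightarrow> real"
  assumes "open \<Omega>" "\<forall>\<epsilon>\<in>{0<..1}. smooth_on \<Omega> (u \<epsilon>)" "\<forall>\<epsilon>\<in>{0<..1}. smooth_on \<Omega> (v \<epsilon>)"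
    and "K \<subseteq> \<Omega>" "\<alpha> \<in> lists {1, \<i>}"
    and "\<forall>\<^sub>F \<epsilon> in at_right 0. \<forall>z\<in>K. cmod (partial_deriv \<alpha> (u \<epsilon>) z) \<le> C * h \<epsilon>"
    and "\<forall>\<^sub>F \<epsilon> in at_right 0. \<forall>z\<in>K. cmod (partial_deriv \<alpha> (v \<epsilon>) z) \<le> D * k \<epsilon>"
    and "\<forall>\<^sub>F \<epsilon> in at_right 0. 0 \<le> h \<epsilon> \<and> h \<epsilon> \<le> l \<epsilon> \<and> 0 \<le> k \<epsilon> \<and> k \<epsilon> \<le> l \<epsilon>"
  shows "\<forall>\<^sub>F \<epsilon> in at_right 0. \<forall>z\<in>K. cmod (partial_deriv \<alpha> (\<lambda>z. a * u \<epsilon> z + b * v \<epsilon> z) z)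
           \<le> (cmod a * \<bar>C\<bar> + cmod b * \<bar>D\<bar>) * l \<epsilon>"
  using ev01 assms(6-8)
proof eventually_elim
  case (elim \<epsilon>)
  show ?case
  proof
    fix z assume "z \<in> K"
    have C: "C * h \<epsilon> \<le> \<bar>C\<bar> * l \<epsilon>" and D: "D * k \<epsilon> \<le> \<bar>D\<bar> * l \<epsilon>"
      using elim(4) by (simp_all add: mult_mono)
    have 1: "cmod (partial_deriv \<alpha> (u \<epsilon>) z) \<le> \<bar>C\<bar> * l \<epsilon>"
      using bspec[OF elim(2) \<open>z \<in> K\<close>] C by (rule order_trans)
    have 2: "cmod (partial_deriv \<alpha> (v \<epsilon>) z) \<le> \<bar>D\<bar> * l \<epsilon>"
      using bspec[OF elim(3) \<open>z \<in> K\<close>] D by (rule order_trans)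
    have "partial_deriv \<alpha> (\<lambda>z. a * u \<epsilon> z + b * v \<epsilon> z) z
        = a * partial_deriv \<alpha> (u \<epsilon>) z + b * partial_deriv \<alpha> (v \<epsilon>) z"
    proof (rule partial_deriv_lincomb[OF assms(1) _ _ assms(5)])
      show "smooth_on \<Omega> (u \<epsilon>)" "smooth_on \<Omega> (v \<epsilon>)" using assms(2,3) elim(1) by simp_all
      show "z \<in> \<Omega>" using assms(4) \<open>z \<in> K\<close> by blast
    qed
    also have "cmod \<dots> \<le> cmod a * cmod (partial_deriv \<alpha> (u \<epsilon>) z) + cmod b * cmod (partial_deriv \<alpha> (v \<epsilon>) z)"
      by (rule order_trans[OF norm_triangle_ineq]) (simp add: norm_mult)
    also have "\<dots> \<le> cmod a * (\<bar>C\<bar> * l \<epsilon>) + cmod b * (\<bar>D\<bar> * l \<epsilon>)"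
      by (intro add_mono mult_left_mono 1 2 norm_ge_zero)
    finally show "cmod (partial_deriv \<alpha> (\<lambda>z. a * u \<epsilon> z + b * v \<epsilon> z) z)
        \<le> (cmod a * \<bar>C\<bar> + cmod b * \<bar>D\<bar>) * l \<epsilon>"
      by (simp add: distrib_right mult.assoc)
  qed
qed

lemma colombeau_moderate_lincomb:
  assumes "open \<Omega>" "u \<in> colombeau_moderate \<Omega>" "v \<in> colombeau_moderate \<Omega>"
  shows "(\<lambda>\<epsilon> z. a * u \<epsilon> z + b * v \<epsilon> z) \<in> colombeau_moderate \<Omega>"
  unfolding colombeau_moderate_iff
proof (intro conjI allI impI ballI)
  show "smooth_on \<Omega> (\<lambda>z. a * u \<epsilon> z + b * v \<epsilon> z)" if "\<epsilon> \<in> {0<..1}" for \<epsilon>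
    by (intro smooth_on_lincomb assms(1) colombeau_moderate_smooth[OF assms(2) that]
        colombeau_moderate_smooth[OF assms(3) that])
next
  fix K \<alpha> assume K: "compact K \<and> K \<noteq> {} \<and> K \<subseteq> \<Omega> \<and> \<alpha> \<in> lists {1, \<i>}"
  obtain N C where
    1: "\<forall>\<^sub>F \<epsilon> in at_right 0. \<forall>z\<in>K. cmod (partial_deriv \<alpha> (u \<epsilon>) z) \<le> C * norm (1 / \<epsilon> ^ N)"
    using colombeau_moderate_bound[OF assms(2) K] by blast
  obtain M D where
    2: "\<forall>\<^sub>F \<epsilon> in at_right 0. \<forall>z\<in>K. cmod (partial_deriv \<alpha> (v \<epsilon>) z) \<le> D * norm (1 / \<epsilon> ^ M)"
    using colombeau_moderate_bound[OF assms(3) K] by blast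
  have 3: "\<forall>\<^sub>F \<epsilon> in at_right 0. 0 \<le> norm (1 / \<epsilon> ^ N) \<and> norm (1 / \<epsilon> ^ N) \<le> norm (1 / \<epsilon> ^ (max M N))
      \<and> 0 \<le> norm (1 / \<epsilon> ^ M) \<and> norm (1 / \<epsilon> ^ M) \<le> norm (1 / (\<epsilon>::real) ^ (max M N))"
    using ev01
  proof eventually_elim
    case (elim \<epsilon>)
    have "norm (1 / \<epsilon> ^ i) \<le> norm (1 / \<epsilon> ^ j)" if "i \<le> j" for i j
      using elim power_decreasing[of i j \<epsilon>] that by (simp add: frac_le)
    then show ?case by simp
  qed
  have "\<forall>\<^sub>F \<epsilon> in at_right 0. \<forall>z\<in>K. cmod (partial_deriv \<alpha> (\<lambda>z. a * u \<epsilon> z + b * v \<epsilon> z) z)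
           \<le> (cmod a * \<bar>C\<bar> + cmod b * \<bar>D\<bar>) * norm (1 / \<epsilon> ^ (max M N))"
    by (rule estimate_lincomb[OF assms(1) _ _ _ _ 1 2 3])
       (use assms(2,3) K colombeau_moderate_smooth in auto)
  then show "\<exists>N::nat. \<exists>C. \<forall>\<^sub>F \<epsilon> in at_right 0. \<forall>z\<in>K.
      cmod (partial_deriv \<alpha> (\<lambda>z. a * u \<epsilon> z + b * v \<epsilon> z) z) \<le> C * norm (1 / \<epsilon> ^ N)" by blast
qed

lemma colombeau_null_lincomb:
  assumes "open \<Omega>" "u \<in> colombeau_null \<Omega>" "v \<in> colombeau_null \<Omega>"
  shows "(\<lambda>\<epsilon> z. a * u \<epsilon> z + b * v \<epsilon> z) \<in> colombeau_null \<Omega>"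
  unfolding colombeau_null_iff
proof (intro conjI allI impI ballI)
  show "smooth_on \<Omega> (\<lambda>z. a * u \<epsilon> z + b * v \<epsilon> z)" if "\<epsilon> \<in> {0<..1}" for \<epsilon>
    by (intro smooth_on_lincomb assms(1) colombeau_null_smooth[OF assms(2) that]
        colombeau_null_smooth[OF assms(3) that])
next
  fix K \<alpha> m assume K: "compact K \<and> K \<noteq> {} \<and> K \<subseteq> \<Omega> \<and> \<alpha> \<in> lists {1, \<i>}"
  obtain C where
    1: "\<forall>\<^sub>F \<epsilon> in at_right 0. \<forall>z\<in>K. cmod (partial_deriv \<alpha> (u \<epsilon>) z) \<le> C * norm (\<epsilon> ^ m)"
    using colombeau_null_bound[OF assms(2) K] by blast
  obtain D where
    2: "\<forall>\<^sub>F \<epsilon> in at_right 0. \<forall>z\<in>K. cmod (partial_deriv \<alpha> (v \<epsilon>) z) \<le> D * norm (\<epsilon> ^ m)"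
    using colombeau_null_bound[OF assms(3) K] by blast
  have "\<forall>\<^sub>F \<epsilon> in at_right 0. \<forall>z\<in>K. cmod (partial_deriv \<alpha> (\<lambda>z. a * u \<epsilon> z + b * v \<epsilon> z) z)
           \<le> (cmod a * \<bar>C\<bar> + cmod b * \<bar>D\<bar>) * norm (\<epsilon> ^ m)"
    by (rule estimate_lincomb[OF assms(1) _ _ _ _ 1 2])
       (use assms(2,3) K colombeau_null_smooth in auto)
  then show "\<exists>C. \<forall>\<^sub>F \<epsilon> in at_right 0. \<forall>z\<in>K.
      cmod (partial_deriv \<alpha> (\<lambda>z. a * u \<epsilon> z + b * v \<epsilon> z) z) \<le> C * norm (\<epsilon> ^ m)" by blast
qed

lemma colombeau_null_zero: "open \<Omega> \<Longrightarrow> (\<lambda>\<epsilon> z. 0) \<in> colombeau_null \<Omega>"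
  by (auto simp: colombeau_null_iff smooth_on_zero partial_deriv_zero intro: exI[of _ 0])

lemma colombeau_null_cong:
  assumes "open \<Omega>" "u \<in> colombeau_null \<Omega>" "\<And>\<epsilon> z. \<epsilon> \<in> {0<..1} \<Longrightarrow> z \<in> \<Omega> \<Longrightarrow> u \<epsilon> z = v \<epsilon> z"
  shows "v \<in> colombeau_null \<Omega>"
  unfolding colombeau_null_iff
proof (intro conjI allI impI ballI)
  show "smooth_on \<Omega> (v \<epsilon>)" if "\<epsilon> \<in> {0<..1}" for \<epsilon>
    by (rule smooth_on_cong[OF assms(1) assms(3)[OF that] colombeau_null_smooth[OF assms(2) that]])
next
  fix K \<alpha> m assume K: "compact K \<and> K \<noteq> {} \<and> K \<subseteq> \<Omega> \<and> \<alpha> \<in> lists {1, \<i>}"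
  obtain C where
    "\<forall>\<^sub>F \<epsilon> in at_right 0. \<forall>z\<in>K. cmod (partial_deriv \<alpha> (u \<epsilon>) z) \<le> C * norm (\<epsilon> ^ m)"
    using colombeau_null_bound[OF assms(2) K] by blast
  with ev01 have "\<forall>\<^sub>F \<epsilon> in at_right 0. \<forall>z\<in>K. cmod (partial_deriv \<alpha> (v \<epsilon>) z) \<le> C * norm (\<epsilon> ^ m)"
  proof eventually_elim
    case (elim \<epsilon>)
    then have "partial_deriv \<alpha> (u \<epsilon>) z = partial_deriv \<alpha> (v \<epsilon>) z" if "z \<in> K" for z
    proof (intro partial_deriv_cong[OF assms(1)] assms(3))
      show "\<epsilon> \<in> {0<..1}" using elim by simp
      show "z \<in> \<Omega>" using K that by blast
    qed
    then show ?case using elim by simp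
  qed
  then show "\<exists>C. \<forall>\<^sub>F \<epsilon> in at_right 0. \<forall>z\<in>K. cmod (partial_deriv \<alpha> (v \<epsilon>) z) \<le> C * norm (\<epsilon> ^ m)"
    by blast
qed

lemma colombeau_moderate_pderiv:
  assumes "u \<in> colombeau_moderate \<Omega>" "v \<in> {1, \<i>}"
  shows "(\<lambda>\<epsilon>. pderiv_dir v (u \<epsilon>)) \<in> colombeau_moderate \<Omega>"
  unfolding colombeau_moderate_iff
proof (intro conjI allI impI ballI)
  show "smooth_on \<Omega> (pderiv_dir v (u \<epsilon>))" if "\<epsilon> \<in> {0<..1}" for \<epsilon>
    by (intro smooth_on_pderiv colombeau_moderate_smooth[OF assms(1) that] assms(2))
next
  fix K \<alpha> assume K: "compact K \<and> K \<noteq> {} \<and> K \<subseteq> \<Omega> \<and> \<alpha> \<in> lists {1, \<i>}"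
  then have K': "compact K \<and> K \<noteq> {} \<and> K \<subseteq> \<Omega> \<and> \<alpha> @ [v] \<in> lists {1, \<i>}" using assms(2) by auto
  have "\<exists>N::nat. \<exists>C. \<forall>\<^sub>F \<epsilon> in at_right 0. \<forall>z\<in>K.
      cmod (partial_deriv (\<alpha> @ [v]) (u \<epsilon>) z) \<le> C * norm (1 / \<epsilon> ^ N)"
    by (rule colombeau_moderate_bound[OF assms(1) K'])
  then show "\<exists>N::nat. \<exists>C. \<forall>\<^sub>F \<epsilon> in at_right 0. \<forall>z\<in>K.
      cmod (partial_deriv \<alpha> (pderiv_dir v (u \<epsilon>)) z) \<le> C * norm (1 / \<epsilon> ^ N)" by simp
qed

lemma colombeau_null_pderiv:
  assumes "u \<in> colombeau_null \<Omega>" "v \<in> {1, \<i>}"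
  shows "(\<lambda>\<epsilon>. pderiv_dir v (u \<epsilon>)) \<in> colombeau_null \<Omega>"
  unfolding colombeau_null_iff
proof (intro conjI allI impI ballI)
  show "smooth_on \<Omega> (pderiv_dir v (u \<epsilon>))" if "\<epsilon> \<in> {0<..1}" for \<epsilon>
    by (intro smooth_on_pderiv colombeau_null_smooth[OF assms(1) that] assms(2))
next
  fix K \<alpha> m assume K: "compact K \<and> K \<noteq> {} \<and> K \<subseteq> \<Omega> \<and> \<alpha> \<in> lists {1, \<i>}"
  then have K': "compact K \<and> K \<noteq> {} \<and> K \<subseteq> \<Omega> \<and> \<alpha> @ [v] \<in> lists {1, \<i>}" using assms(2) by auto
  have "\<exists>C. \<forall>\<^sub>F \<epsilon> in at_right 0. \<forall>z\<in>K.
      cmod (partial_deriv (\<alpha> @ [v]) (u \<epsilon>) z) \<le> C * norm (\<epsilon> ^ m)"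
    by (rule colombeau_null_bound[OF assms(1) K'])
  then show "\<exists>C. \<forall>\<^sub>F \<epsilon> in at_right 0. \<forall>z\<in>K.
      cmod (partial_deriv \<alpha> (pderiv_dir v (u \<epsilon>)) z) \<le> C * norm (\<epsilon> ^ m)" by simp
qed

lemma equiv_colombeau_rel:
  assumes "open \<Omega>"
  shows "equiv (colombeau_moderate \<Omega>) (colombeau_rel \<Omega>)"
proof (rule equivI)
  show "colombeau_rel \<Omega> \<subseteq> colombeau_moderate \<Omega> \<times> colombeau_moderate \<Omega>"
    by (auto simp: colombeau_rel_def)
  show "refl_on (colombeau_moderate \<Omega>) (colombeau_rel \<Omega>)"
    using colombeau_null_zero[OF assms] by (auto simp: refl_on_def colombeau_rel_def)
  show "sym (colombeau_rel \<Omega>)"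
  proof (rule symI)
    fix u v assume "(u, v) \<in> colombeau_rel \<Omega>"
    then show "(v, u) \<in> colombeau_rel \<Omega>"
      using colombeau_null_lincomb[OF assms, of "\<lambda>\<epsilon> z. u \<epsilon> z - v \<epsilon> z" "\<lambda>\<epsilon> z. u \<epsilon> z - v \<epsilon> z" "-1" 0]
      by (simp add: colombeau_rel_def)
  qed
  show "trans (colombeau_rel \<Omega>)"
  proof (rule transI)
    fix u v w assume "(u, v) \<in> colombeau_rel \<Omega>" "(v, w) \<in> colombeau_rel \<Omega>"
    then show "(u, w) \<in> colombeau_rel \<Omega>"
      using colombeau_null_lincomb[OF assms, of "\<lambda>\<epsilon> z. u \<epsilon> z - v \<epsilon> z" "\<lambda>\<epsilon> z. v \<epsilon> z - w \<epsilon> z" 1 1]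
      by (simp add: colombeau_rel_def)
  qed
qed

lemma gfun_lift_wirtinger:
  assumes "open \<Omega>" and D: "\<And>g z. D g z = a * pderiv_dir 1 g z + b * pderiv_dir \<i> g z"
    and "u \<in> colombeau_moderate \<Omega>"
  shows "gfun_lift \<Omega> D (gfun_class \<Omega> u) = gfun_class \<Omega> (\<lambda>\<epsilon>. D (u \<epsilon>))"
    and "(\<lambda>\<epsilon>. D (u \<epsilon>)) \<in> colombeau_moderate \<Omega>"
proof -
  have D': "D g = (\<lambda>z. a * pderiv_dir 1 g z + b * pderiv_dir \<i> g z)" for g
    by (simp add: D fun_eq_iff)
  have mod: "(\<lambda>\<epsilon>. D (u \<epsilon>)) \<in> colombeau_moderate \<Omega>" if "u \<in> colombeau_moderate \<Omega>" for u
    unfolding D' using that assms(1)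
    by (intro colombeau_moderate_lincomb colombeau_moderate_pderiv) auto
  show "(\<lambda>\<epsilon>. D (u \<epsilon>)) \<in> colombeau_moderate \<Omega>" using mod assms by auto
  have "(\<lambda>u. gfun_class \<Omega> (\<lambda>\<epsilon>. D (u \<epsilon>))) respects colombeau_rel \<Omega>"
  proof (rule congruentI)
    fix u v assume uv: "(u, v) \<in> colombeau_rel \<Omega>"
    let ?w = "\<lambda>\<epsilon> z. u \<epsilon> z - v \<epsilon> z"
    have null: "(\<lambda>\<epsilon>. D (?w \<epsilon>)) \<in> colombeau_null \<Omega>"
      unfolding D' using uv assms(1)
      by (intro colombeau_null_lincomb[of \<Omega> "\<lambda>\<epsilon>. pderiv_dir 1 (?w \<epsilon>)" "\<lambda>\<epsilon>. pderiv_dir \<i> (?w \<epsilon>)"]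
          colombeau_null_pderiv) (auto simp: colombeau_rel_def)
    have eq: "D (?w \<epsilon>) z = D (u \<epsilon>) z - D (v \<epsilon>) z" if "\<epsilon> \<in> {0<..1}" "z \<in> \<Omega>" for \<epsilon> z
    proof -
      have "smooth_on \<Omega> (u \<epsilon>)" "smooth_on \<Omega> (v \<epsilon>)"
        using uv that colombeau_moderate_smooth by (auto simp: colombeau_rel_def)
      then have "partial_deriv [d] (?w \<epsilon>) z = partial_deriv [d] (u \<epsilon>) z - partial_deriv [d] (v \<epsilon>) z"
        if "d \<in> {1, \<i>}" for d
        using partial_deriv_lincomb[OF assms(1), of "u \<epsilon>" "v \<epsilon>" "[d]" z 1 "-1"] that \<open>z \<in> \<Omega>\<close> by auto
      from this[of 1] this[of \<i>]
      have "pderiv_dir 1 (?w \<epsilon>) z = pderiv_dir 1 (u \<epsilon>) z - pderiv_dir 1 (v \<epsilon>) z"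
        and "pderiv_dir \<i> (?w \<epsilon>) z = pderiv_dir \<i> (u \<epsilon>) z - pderiv_dir \<i> (v \<epsilon>) z"
        by simp_all
      then show ?thesis unfolding D by (simp only:) (simp add: algebra_simps)
    qed
    have "(\<lambda>\<epsilon> z. D (u \<epsilon>) z - D (v \<epsilon>) z) \<in> colombeau_null \<Omega>"
      using eq by (rule colombeau_null_cong[OF assms(1) null])
    then have "((\<lambda>\<epsilon>. D (u \<epsilon>)), (\<lambda>\<epsilon>. D (v \<epsilon>))) \<in> colombeau_rel \<Omega>"
      using mod uv by (auto simp: colombeau_rel_def)
    then show "gfun_class \<Omega> (\<lambda>\<epsilon>. D (u \<epsilon>)) = gfun_class \<Omega> (\<lambda>\<epsilon>. D (v \<epsilon>))"
      unfolding gfun_class_def by (rule equiv_class_eq[OF equiv_colombeau_rel[OF assms(1)]])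
  qed
  from UN_equiv_class[OF equiv_colombeau_rel[OF assms(1)] this assms(3)]
  show "gfun_lift \<Omega> D (gfun_class \<Omega> u) = gfun_class \<Omega> (\<lambda>\<epsilon>. D (u \<epsilon>))"
    by (simp add: gfun_lift_def gfun_class_def)
qed

lemma gfun_lift_dbar:
  assumes "open \<Omega>" "u \<in> colombeau_moderate \<Omega>"
  shows "gfun_lift \<Omega> dbar (gfun_class \<Omega> u) = gfun_class \<Omega> (\<lambda>\<epsilon>. dbar (u \<epsilon>))"
  by (rule gfun_lift_wirtinger(1)[of _ _ "1/2" "\<i>/2"]) (use assms in \<open>auto simp: dbar_def field_simps\<close>)

lemma gfun_deriv_class:
  assumes "open \<Omega>" "u \<in> colombeau_moderate \<Omega>"
  shows "gfun_deriv \<Omega> n (gfun_class \<Omega> u) = gfun_class \<Omega> (\<lambda>\<epsilon>. (dz ^^ n) (u \<epsilon>))"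
    and "(\<lambda>\<epsilon>. (dz ^^ n) (u \<epsilon>)) \<in> colombeau_moderate \<Omega>"
proof -
  have dz: "dz g z = 1/2 * pderiv_dir 1 g z + (-\<i>/2) * pderiv_dir \<i> g z" for g z
    by (simp add: dz_def field_simps)
  have "gfun_deriv \<Omega> n (gfun_class \<Omega> u) = gfun_class \<Omega> (\<lambda>\<epsilon>. (dz ^^ n) (u \<epsilon>)) \<and>
      (\<lambda>\<epsilon>. (dz ^^ n) (u \<epsilon>)) \<in> colombeau_moderate \<Omega>"
  proof (induction n)
    case (Suc n)
    then show ?case
      using gfun_lift_wirtinger[OF assms(1) dz, of "\<lambda>\<epsilon>. (dz ^^ n) (u \<epsilon>)"]
      by (simp add: gfun_deriv_def)
  qed (use assms in \<open>simp add: gfun_deriv_def\<close>)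
  then show "gfun_deriv \<Omega> n (gfun_class \<Omega> u) = gfun_class \<Omega> (\<lambda>\<epsilon>. (dz ^^ n) (u \<epsilon>))"
    and "(\<lambda>\<epsilon>. (dz ^^ n) (u \<epsilon>)) \<in> colombeau_moderate \<Omega>" by auto
qed

section \<open>Point values\<close>

definition compactly_supported :: "complex set \<Rightarrow> (real \<Rightarrow> complex) \<Rightarrow> bool" where
  "compactly_supported \<Omega> z \<longleftrightarrow> (\<forall>\<epsilon>\<in>{0<..1}. z \<epsilon> \<in> \<Omega>) \<and>
     (\<exists>K. compact K \<and> K \<subseteq> \<Omega> \<and> (\<forall>\<^sub>F \<epsilon> in at_right 0. z \<epsilon> \<in> K))"

definition gen_points :: "complex set \<Rightarrow> gcomplex set" where
  "gen_points \<Omega> = abs_gcomplex ` {z. compactly_supported \<Omega> z}"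

text \<open>Lemma \<open>gfun_eval_class\<close> below shows that the value does not depend on the representatives.\<close>

definition gfun_eval :: "complex set \<Rightarrow> gfun \<Rightarrow> gcomplex \<Rightarrow> gcomplex" where
  "gfun_eval \<Omega> f w = (THE y. \<exists>u\<in>f. \<exists>z. compactly_supported \<Omega> z \<and> w = abs_gcomplex z \<and>
     y = abs_gcomplex (\<lambda>\<epsilon>. u \<epsilon> (z \<epsilon>)))"

lemma decays_bound:
  assumes "\<forall>\<^sub>F \<epsilon> in at_right 0. cmod (x \<epsilon>) \<le> C * \<epsilon> powr b" "a < b"
  shows "decays x a"
  unfolding decays_def
proof (rule Lim_null_comparison)
  have "((\<lambda>\<epsilon>::real. \<epsilon> powr (b - a)) \<longlongrightarrow> 0 powr (b - a)) (at_right 0)"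
    using assms(2) ev01
    by (intro tendsto_powr' tendsto_ident_at tendsto_const) (auto elim: eventually_mono)
  then show "((\<lambda>\<epsilon>. C * \<epsilon> powr (b - a)) \<longlongrightarrow> 0) (at_right 0)"
    using tendsto_mult_right_zero[of _ _ C] assms(2) by simp
  show "\<forall>\<^sub>F \<epsilon> in at_right 0. norm (cmod (x \<epsilon>) / \<epsilon> powr a) \<le> C * \<epsilon> powr (b - a)"
    using ev01 assms(1) by eventually_elim (simp add: powr_diff field_simps)
qed

lemma compactly_supported_moderate:
  assumes "compactly_supported \<Omega> z"
  shows "moderate z"
proof -
  obtain K where K: "compact K" "\<forall>\<^sub>F \<epsilon> in at_right 0. z \<epsilon> \<in> K"
    using assms by (auto simp: compactly_supported_def)
  obtain B where B: "\<And>w. w \<in> K \<Longrightarrow> norm w \<le> B"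
    using compact_imp_bounded[OF K(1)] unfolding bounded_iff by blast
  have "\<forall>\<^sub>F \<epsilon> in at_right 0. cmod (z \<epsilon>) \<le> B * \<epsilon> powr 0"
    using K(2) ev01 by eventually_elim (simp add: B)
  then have "decays z (-1)" by (rule decays_bound) simp
  then show ?thesis by (auto simp: moderate_def)
qed

lemma compactly_supported_obtain:
  assumes "compactly_supported \<Omega> z"
  obtains K where "compact K" "K \<noteq> {}" "K \<subseteq> \<Omega>" "\<forall>\<^sub>F \<epsilon> in at_right 0. z \<epsilon> \<in> K"
proof -
  obtain K where K: "compact K" "K \<subseteq> \<Omega>" "\<forall>\<^sub>F \<epsilon> in at_right 0. z \<epsilon> \<in> K"
    using assms by (auto simp: compactly_supported_def)
  have "K \<noteq> {}" using eventually_happens'[OF _ K(3)] by auto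
  with K show ?thesis using that by blast
qed

lemma colombeau_bound_moderate:
  assumes "u \<in> colombeau_moderate \<Omega>" "compact K" "K \<noteq> {}" "K \<subseteq> \<Omega>" "\<alpha> \<in> lists {1, \<i>}"
  obtains m where "moderate (\<lambda>\<epsilon>. of_real (m \<epsilon>))"
    "\<forall>\<^sub>F \<epsilon> in at_right 0. 0 \<le> m \<epsilon> \<and> (\<forall>z\<in>K. cmod (partial_deriv \<alpha> (u \<epsilon>) z) \<le> m \<epsilon>)"
proof -
  obtain N C where *: "\<forall>\<^sub>F \<epsilon> in at_right 0. \<forall>z\<in>K. cmod (partial_deriv \<alpha> (u \<epsilon>) z) \<le> C * norm (1 / \<epsilon> ^ N)"
    using colombeau_moderate_bound[OF assms(1), of K \<alpha>] assms(2-5) by blast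
  define m where "m = (\<lambda>\<epsilon>. \<bar>C\<bar> * norm (1 / (\<epsilon>::real) ^ N))"
  have "\<forall>\<^sub>F \<epsilon> in at_right 0. cmod (of_real (m \<epsilon>)) \<le> \<bar>C\<bar> * \<epsilon> powr (- real N)"
    using ev01
  proof eventually_elim
    case (elim \<epsilon>)
    then have "\<epsilon> powr (- real N) = 1 / \<epsilon> ^ N" by (simp add: powr_minus powr_realpow divide_inverse)
    then show ?case using elim by (simp add: m_def norm_divide norm_power)
  qed
  then have "decays (\<lambda>\<epsilon>. of_real (m \<epsilon>)) (- real N - 1)" by (rule decays_bound) simp
  then have "moderate (\<lambda>\<epsilon>. of_real (m \<epsilon>))" by (auto simp: moderate_def)
  moreover have "\<forall>\<^sub>F \<epsilon> in at_right 0. 0 \<le> m \<epsilon> \<and> (\<forall>z\<in>K. cmod (partial_deriv \<alpha> (u \<epsilon>) z) \<le> m \<epsilon>)"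
    using *
  proof eventually_elim
    case (elim \<epsilon>)
    have "C * norm (1 / \<epsilon> ^ N) \<le> m \<epsilon>" unfolding m_def by (intro mult_right_mono) auto
    moreover have "0 \<le> m \<epsilon>" by (simp add: m_def)
    ultimately show ?case using elim order_trans by blast
  qed
  ultimately show ?thesis by (rule that)
qed

lemma decays_le:
  assumes "\<forall>\<^sub>F \<epsilon> in at_right 0. cmod (x \<epsilon>) \<le> cmod (y \<epsilon>)" "decays y a"
  shows "decays x a"
  unfolding decays_def
proof (rule Lim_null_comparison)
  show "((\<lambda>\<epsilon>. cmod (y \<epsilon>) / \<epsilon> powr a) \<longlongrightarrow> 0) (at_right 0)"
    using assms(2) by (simp add: decays_def)
  show "\<forall>\<^sub>F \<epsilon> in at_right 0. norm (cmod (x \<epsilon>) / \<epsilon> powr a) \<le> cmod (y \<epsilon>) / \<epsilon> powr a"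
    using assms(1) by eventually_elim (auto intro!: divide_right_mono)
qed

lemma moderate_point_value:
  assumes "u \<in> colombeau_moderate \<Omega>" "compactly_supported \<Omega> z"
  shows "moderate (\<lambda>\<epsilon>. u \<epsilon> (z \<epsilon>))"
proof -
  obtain K where K: "compact K" "K \<noteq> {}" "K \<subseteq> \<Omega>" "\<forall>\<^sub>F \<epsilon> in at_right 0. z \<epsilon> \<in> K"
    using assms(2) by (rule compactly_supported_obtain)
  obtain m where m: "moderate (\<lambda>\<epsilon>. of_real (m \<epsilon>))"
    "\<forall>\<^sub>F \<epsilon> in at_right 0. 0 \<le> m \<epsilon> \<and> (\<forall>z\<in>K. cmod (partial_deriv [] (u \<epsilon>) z) \<le> m \<epsilon>)"
    by (rule colombeau_bound_moderate[OF assms(1) K(1-3), of "[]"]) auto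
  have "\<forall>\<^sub>F \<epsilon> in at_right 0. cmod (u \<epsilon> (z \<epsilon>)) \<le> cmod (of_real (m \<epsilon>))"
    using K(4) m(2) by eventually_elim auto
  then have "decays (\<lambda>\<epsilon>. u \<epsilon> (z \<epsilon>)) a" if "decays (\<lambda>\<epsilon>. of_real (m \<epsilon>)) a" for a
    using that by (rule decays_le)
  with m(1) show ?thesis unfolding moderate_def by blast
qed

lemma null_point_value:
  assumes "u \<in> colombeau_null \<Omega>" "compactly_supported \<Omega> z"
  shows "null (\<lambda>\<epsilon>. u \<epsilon> (z \<epsilon>))"
  unfolding null_def
proof
  fix a
  obtain K where K: "compact K" "K \<noteq> {}" "K \<subseteq> \<Omega>" "\<forall>\<^sub>F \<epsilon> in at_right 0. z \<epsilon> \<in> K"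
    using assms(2) by (rule compactly_supported_obtain)
  obtain m where m: "a < real m" using reals_Archimedean2 by blast
  have "\<exists>C. \<forall>\<^sub>F \<epsilon> in at_right 0. \<forall>z\<in>K. cmod (partial_deriv [] (u \<epsilon>) z) \<le> C * norm (\<epsilon> ^ m)"
    using K by (intro colombeau_null_bound[OF assms(1)]) auto
  then obtain C where "\<forall>\<^sub>F \<epsilon> in at_right 0. \<forall>z\<in>K. cmod (u \<epsilon> z) \<le> C * norm (\<epsilon> ^ m)" by auto
  with K(4) ev01 have "\<forall>\<^sub>F \<epsilon> in at_right 0. cmod (u \<epsilon> (z \<epsilon>)) \<le> C * \<epsilon> powr real m"
    by eventually_elim (simp add: powr_realpow)
  then show "decays (\<lambda>\<epsilon>. u \<epsilon> (z \<epsilon>)) a" using m by (rule decays_bound)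
qed

lemma point_value_cong:
  assumes "open \<Omega>" "u \<in> colombeau_moderate \<Omega>" "compactly_supported \<Omega> z" "compactly_supported \<Omega> w"
    and null: "null (\<lambda>\<epsilon>. z \<epsilon> - w \<epsilon>)"
  shows "null (\<lambda>\<epsilon>. u \<epsilon> (z \<epsilon>) - u \<epsilon> (w \<epsilon>))"
proof -
  obtain K where K: "compact K" "K \<noteq> {}" "K \<subseteq> \<Omega>" "\<forall>\<^sub>F \<epsilon> in at_right 0. z \<epsilon> \<in> K"
    using assms(3) by (rule compactly_supported_obtain)
  obtain \<delta> where \<delta>: "\<delta> > 0" "(\<Union>x\<in>K. cball x \<delta>) \<subseteq> \<Omega>"
    using compact_subset_open_imp_cball_epsilon_subset[OF K(1) assms(1) K(3)] by blast
  define L where "L = (\<Union>x\<in>K. cball x \<delta>)"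
  have L: "compact L" "L \<noteq> {}" "L \<subseteq> \<Omega>"
    unfolding L_def using \<delta> K by (auto intro!: compact_minkowski_sum_cball)
  obtain m1 where m1: "moderate (\<lambda>\<epsilon>. of_real (m1 \<epsilon>))"
    "\<forall>\<^sub>F \<epsilon> in at_right 0. 0 \<le> m1 \<epsilon> \<and> (\<forall>z\<in>L. cmod (partial_deriv [1] (u \<epsilon>) z) \<le> m1 \<epsilon>)"
    by (rule colombeau_bound_moderate[OF assms(2) L, of "[1]"]) auto
  obtain m2 where m2: "moderate (\<lambda>\<epsilon>. of_real (m2 \<epsilon>))"
    "\<forall>\<^sub>F \<epsilon> in at_right 0. 0 \<le> m2 \<epsilon> \<and> (\<forall>z\<in>L. cmod (partial_deriv [\<i>] (u \<epsilon>) z) \<le> m2 \<epsilon>)"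
    by (rule colombeau_bound_moderate[OF assms(2) L, of "[\<i>]"]) auto
  have "decays (\<lambda>\<epsilon>. z \<epsilon> - w \<epsilon>) 0" using null by (simp add: null_def)
  then have "\<forall>\<^sub>F \<epsilon> in at_right 0. cmod (z \<epsilon> - w \<epsilon>) / \<epsilon> powr 0 < \<delta>"
    unfolding decays_def by (rule order_tendstoD(2)) (use \<delta> in auto)
  with ev01 have close: "\<forall>\<^sub>F \<epsilon> in at_right 0. cmod (z \<epsilon> - w \<epsilon>) < \<delta>"
    by eventually_elim simp
  have "\<forall>\<^sub>F \<epsilon> in at_right 0. cmod (u \<epsilon> (z \<epsilon>) - u \<epsilon> (w \<epsilon>))
      \<le> cmod ((of_real (m1 \<epsilon>) + of_real (m2 \<epsilon>)) * (z \<epsilon> - w \<epsilon>))"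
    using ev01 K(4) m1(2) m2(2) close
  proof eventually_elim
    case (elim \<epsilon>)
    let ?B = "cball (z \<epsilon>) \<delta>"
    have sub: "?B \<subseteq> L" using elim by (auto simp: L_def)
    have sm: "smooth_on \<Omega> (u \<epsilon>)" using colombeau_moderate_smooth[OF assms(2)] elim by auto
    have "norm (u \<epsilon> (z \<epsilon>) - u \<epsilon> (w \<epsilon>)) \<le> (m1 \<epsilon> + m2 \<epsilon>) * norm (z \<epsilon> - w \<epsilon>)"
    proof (rule differentiable_bound[of ?B _ "\<lambda>x. frechet_derivative (u \<epsilon>) (at x)"])
      fix x assume x: "x \<in> ?B"
      have "partial_deriv [] (u \<epsilon>) differentiable (at x)"
        using sm x sub L(3) unfolding smooth_on_def by blast
      then have hd: "(u \<epsilon> has_derivative frechet_derivative (u \<epsilon>) (at x)) (at x)"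
        by (simp add: frechet_derivative_works)
      then show "(u \<epsilon> has_derivative frechet_derivative (u \<epsilon>) (at x)) (at x within ?B)"
        by (rule has_derivative_at_withinI)
      interpret lin: bounded_linear "frechet_derivative (u \<epsilon>) (at x)"
        using hd by (rule has_derivative_bounded_linear)
      show "onorm (frechet_derivative (u \<epsilon>) (at x)) \<le> m1 \<epsilon> + m2 \<epsilon>"
      proof (rule onorm_le)
        fix h :: complex
        have h: "h = Re h *\<^sub>R 1 + Im h *\<^sub>R \<i>" by (simp add: complex_eq_iff)
        have "frechet_derivative (u \<epsilon>) (at x) h
            = Re h *\<^sub>R pderiv_dir 1 (u \<epsilon>) x + Im h *\<^sub>R pderiv_dir \<i> (u \<epsilon>) x"
          by (subst h) (simp only: lin.add lin.scaleR pderiv_dir_def)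
        also have "norm \<dots> \<le> \<bar>Re h\<bar> * cmod (pderiv_dir 1 (u \<epsilon>) x) + \<bar>Im h\<bar> * cmod (pderiv_dir \<i> (u \<epsilon>) x)"
          by (rule order_trans[OF norm_triangle_ineq]) simp
        also have "\<dots> \<le> norm h * m1 \<epsilon> + norm h * m2 \<epsilon>"
          using elim x sub abs_Re_le_cmod[of h] abs_Im_le_cmod[of h]
          by (intro add_mono mult_mono) auto
        finally show "norm (frechet_derivative (u \<epsilon>) (at x) h) \<le> (m1 \<epsilon> + m2 \<epsilon>) * norm h"
          by (simp add: algebra_simps)
      qed
    qed (use elim \<delta>(1) in \<open>auto simp: dist_norm\<close>)
    also have "\<dots> = cmod ((of_real (m1 \<epsilon>) + of_real (m2 \<epsilon>)) * (z \<epsilon> - w \<epsilon>))"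
      using elim by (simp add: norm_mult flip: of_real_add)
    finally show ?case .
  qed
  moreover have "null (\<lambda>\<epsilon>. (of_real (m1 \<epsilon>) + of_real (m2 \<epsilon>)) * (z \<epsilon> - w \<epsilon>))"
    using m1(1) m2(1) null by (intro null_mult moderate_add)
  ultimately show ?thesis unfolding null_def by (intro allI) (rule decays_le, auto)
qed

lemma gfun_eval_class:
  assumes "open \<Omega>" "u \<in> colombeau_moderate \<Omega>" "compactly_supported \<Omega> z"
  shows "gfun_eval \<Omega> (gfun_class \<Omega> u) (abs_gcomplex z) = abs_gcomplex (\<lambda>\<epsilon>. u \<epsilon> (z \<epsilon>))"
  unfolding gfun_eval_def
proof (rule the_equality)
  have "u \<in> gfun_class \<Omega> u"
    unfolding gfun_class_def using equiv_class_self[OF equiv_colombeau_rel[OF assms(1)] assms(2)] .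
  then show "\<exists>v\<in>gfun_class \<Omega> u. \<exists>z'. compactly_supported \<Omega> z' \<and> abs_gcomplex z = abs_gcomplex z' \<and>
      abs_gcomplex (\<lambda>\<epsilon>. u \<epsilon> (z \<epsilon>)) = abs_gcomplex (\<lambda>\<epsilon>. v \<epsilon> (z' \<epsilon>))"
    using assms(3) by blast
next
  fix y assume "\<exists>v\<in>gfun_class \<Omega> u. \<exists>z'. compactly_supported \<Omega> z' \<and> abs_gcomplex z = abs_gcomplex z' \<and>
      y = abs_gcomplex (\<lambda>\<epsilon>. v \<epsilon> (z' \<epsilon>))"
  then obtain v w where v: "(u, v) \<in> colombeau_rel \<Omega>" and w: "compactly_supported \<Omega> w"
    and eq: "abs_gcomplex z = abs_gcomplex w" and y: "y = abs_gcomplex (\<lambda>\<epsilon>. v \<epsilon> (w \<epsilon>))"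
    by (auto simp: gfun_class_def)
  have vm: "v \<in> colombeau_moderate \<Omega>" and uv: "(\<lambda>\<epsilon> z. u \<epsilon> z - v \<epsilon> z) \<in> colombeau_null \<Omega>"
    using v by (auto simp: colombeau_rel_def)
  have "gc_rel z w"
    using Quotient_rel[OF Quotient_gcomplex, of z w] eq gc_rel_refl
      compactly_supported_moderate[OF assms(3)] compactly_supported_moderate[OF w] by blast
  then have "null (\<lambda>\<epsilon>. z \<epsilon> - w \<epsilon>)" by (simp add: gc_rel_def)
  then have "null (\<lambda>\<epsilon>. (u \<epsilon> (z \<epsilon>) - u \<epsilon> (w \<epsilon>)) + (u \<epsilon> (w \<epsilon>) - v \<epsilon> (w \<epsilon>)))"
    using null_point_value[OF uv w] point_value_cong[OF assms(1,2,3) w] by (intro null_add) auto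
  then have "gc_rel (\<lambda>\<epsilon>. u \<epsilon> (z \<epsilon>)) (\<lambda>\<epsilon>. v \<epsilon> (w \<epsilon>))"
    using moderate_point_value[OF assms(2,3)] moderate_point_value[OF vm w] by (simp add: gc_rel_def)
  then show "y = abs_gcomplex (\<lambda>\<epsilon>. u \<epsilon> (z \<epsilon>))"
    using Quotient_rel[OF Quotient_gcomplex] y by metis
qed

section \<open>Identity Theorem and dense ideals\<close>

definition satisfies_identity_theorem :: "complex set \<Rightarrow> gfun \<Rightarrow> bool" where
  "satisfies_identity_theorem \<Omega> f \<longleftrightarrow>
     (\<forall>z0\<in>gen_points \<Omega>.
        top_of_set (gen_points \<Omega>) derived_set_of
          {z \<in> gen_points \<Omega>. gfun_eval \<Omega> f z = gfun_eval \<Omega> f z0} = {})"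

text \<open>Ideals of a commutative ring are its submodules as a module over itself.\<close>

global_interpretation ring_module: module "(*) :: 'a::comm_ring_1 \<Rightarrow> 'a \<Rightarrow> 'a"
  defines is_ideal = ring_module.subspace and ideal_generated = ring_module.span
  by unfold_locales (simp_all add: algebra_simps)

definition dense_ideal :: "'a::comm_ring_1 set \<Rightarrow> bool" where
  "dense_ideal J \<longleftrightarrow> is_ideal J \<and>
     (\<forall>r1 r2. r1 \<noteq> 0 \<longrightarrow> (\<exists>r. r1 * r \<noteq> 0 \<and> r2 * r \<in> J))"

definition coeff_ideal :: "complex set \<Rightarrow> gfun \<Rightarrow> gcomplex \<Rightarrow> gcomplex set" where
  "coeff_ideal \<Omega> f z0 =
     ideal_generated {gfun_eval \<Omega> (gfun_deriv \<Omega> n f) z0 | n. n \<ge> 1}"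

end

theory Submission
  imports Defs
begin

text \<open>
  The proof is by contraposition: if \<open>C_f(z0)\<close> is not dense, then \<open>z0\<close> is an accumulation point of its
  own fibre \<open>f\<inverse>(f(z0))\<close>.

  Algebra. Suppose that \<open>r1 \<noteq> 0\<close> and \<open>r2\<close> witness that an ideal \<open>J\<close> is not dense. For \<open>x \<in> J\<close> the
  product \<open>r2 x\<close> lies in \<open>J\<close>, so \<open>r1 x = 0\<close>. A nonzero generalized number is bounded below by some
  \<open>c \<epsilon>\<^sup>b\<close> on a set \<open>S\<close> of parameters that accumulates at \<open>0\<close>, so it is invertible there: a multiple
  of \<open>r1\<close> is the idempotent \<open>e_S\<close>, the class of the characteristic function of \<open>S\<close>. Hence
  \<open>e_S J = 0\<close> (lemma \<open>annihilated_if_not_dense\<close>). For \<open>J = C_f(z0)\<close> this says that all derivatives of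
  order at least one are null at \<open>z0\<close> along \<open>S\<close>.

  Analysis. Let \<open>u\<close> represent \<open>f\<close> and \<open>z\<close> represent \<open>z0\<close>. For a holomorphic net the
  Taylor series shows \<open>u (z + h) - u z\<close> to be null along \<open>S\<close> whenever \<open>|h| \<le> \<epsilon>\<^sup>a\<close> with \<open>a > 0\<close>.
  The essential point is that the bounds \<open>O(\<epsilon>\<^sup>p)\<close> for the derivatives of \<open>u\<close> on a compact set can be
  taken with one exponent \<open>p\<close> for all orders, since then a Taylor remainder of order \<open>m\<close> is
  \<open>O(\<epsilon>\<^bsup>p + m a\<^esup>)\<close>, and \<open>m\<close> is arbitrary. For merely smooth nets this fails. Here \<open>dbar u\<close> is null,
  which gives Cauchy estimates up to null errors (lemmas \<open>cauchy_estimate_dbar\<close> and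
  \<open>bigo_on_dz_funpow\<close>). Instead of a Taylor formula, the mean value inequality is iterated from high
  orders of differentiation down to order zero (lemma \<open>bigo_on_increment_of_null_derivatives\<close>).

  Moving \<open>z\<close> by \<open>\<epsilon>\<^sup>a\<close> along \<open>S\<close>, and not at all off \<open>S\<close>, gives points of the fibre that differ from \<open>z0\<close>
  because \<open>S\<close> accumulates at \<open>0\<close> and come arbitrarily close to \<open>z0\<close> in the sharp topology as \<open>a\<close> grows
  (lemma \<open>accumulation_if_null_derivatives\<close>).
\<close>

section \<open>Wirtinger derivatives\<close>

(* Multiplication seen as the scalar multiplication of the ring over itself makes associativity, read
   from right to left, a rewrite rule; it would loop with algebra_simps. *)
declare ring_module.scale_scale [simp del]

lemma has_derivative_wirtinger:
  assumes "g differentiable (at z)"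
  shows "(g has_derivative (\<lambda>v. v * dz g z + cnj v * dbar g z)) (at z)"
proof -
  let ?L = "frechet_derivative g (at z)"
  have L: "(g has_derivative ?L) (at z)"
    using assms by (simp add: frechet_derivative_works)
  then interpret bounded_linear ?L by (rule has_derivative_bounded_linear)
  have "?L v = v * dz g z + cnj v * dbar g z" for v
  proof -
    have "?L v = ?L (Re v *\<^sub>R 1 + Im v *\<^sub>R \<i>)"
      by (rule arg_cong[of _ _ ?L]) (simp add: complex_eq_iff)
    also have "\<dots> = of_real (Re v) * pderiv_dir 1 g z + of_real (Im v) * pderiv_dir \<i> g z"
      by (simp only: add scaleR pderiv_dir_def) (simp add: scaleR_conv_of_real)
    also have "\<dots> = v * dz g z + cnj v * dbar g z"
    proof -
      have "v * (a - b) + cnj v * (a + b) = (v + cnj v) * a - (v - cnj v) * b" for a b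
        by (simp add: algebra_simps)
      then have eq: "v * ((a - b) / 2) + cnj v * ((a + b) / 2) = (v + cnj v) / 2 * a - (v - cnj v) / 2 * b" for a b
        unfolding times_divide_eq_right times_divide_eq_left
          add_divide_distrib[symmetric] diff_divide_distrib[symmetric] by (rule arg_cong)
      have eq': "complex_of_real (2 * y) * \<i> / 2 * (\<i> * b) = - (of_real y * b)" for y b
        by (simp add: complex_eq_iff)
      show ?thesis
        unfolding dz_def dbar_def eq complex_add_cnj complex_diff_cnj eq' by simp
    qed
    finally show ?thesis .
  qed
  then have "?L = (\<lambda>v. v * dz g z + cnj v * dbar g z)" by (rule ext)
  then show ?thesis using L by (simp only:)
qed

lemma has_vector_derivative_wirtinger:
  assumes "g differentiable (at (\<gamma> t))" "(\<gamma> has_vector_derivative v) (at t within T)"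
  shows "((\<lambda>t. g (\<gamma> t)) has_vector_derivative (v * dz g (\<gamma> t) + cnj v * dbar g (\<gamma> t)))
           (at t within T)"
proof -
  have "((g \<circ> \<gamma>) has_derivative ((\<lambda>v. v * dz g (\<gamma> t) + cnj v * dbar g (\<gamma> t)) \<circ> (\<lambda>h. h *\<^sub>R v)))
          (at t within T)"
    by (intro diff_chain_within has_derivative_at_withinI[OF has_derivative_wirtinger]
        assms(1) assms(2)[unfolded has_vector_derivative_def])
  moreover have "(\<lambda>v. v * dz g (\<gamma> t) + cnj v * dbar g (\<gamma> t)) \<circ> (\<lambda>h. h *\<^sub>R v)
      = (\<lambda>h. h *\<^sub>R (v * dz g (\<gamma> t) + cnj v * dbar g (\<gamma> t)))"
    by (simp add: fun_eq_iff scaleR_add_right)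
  ultimately show ?thesis
    by (simp add: has_vector_derivative_def o_def)
qed

lemma pderiv_dir_wirtinger:
  assumes "g differentiable (at z)"
  shows "pderiv_dir v g z = v * dz g z + cnj v * dbar g z"
proof -
  have "(\<lambda>v. v * dz g z + cnj v * dbar g z) = frechet_derivative g (at z)"
    by (rule frechet_derivative_at[OF has_derivative_wirtinger[OF assms]])
  then show ?thesis unfolding pderiv_dir_def by (rule fun_cong[OF sym])
qed

text \<open>
  The quotient below is symmetric in the directions \<open>a\<close> and \<open>b\<close>, so its limit proves that iterated
  partial derivatives commute. The increment \<open>f (z + t a + h b) - f (z + t a)\<close> has \<open>t\<close>-derivative
  \<open>p (z + t a + h b) - p (z + t a)\<close> with \<open>p\<close> the derivative of \<open>f\<close> in direction \<open>a\<close>; differentiability of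
  \<open>p\<close> at \<open>z\<close> makes this \<open>h\<close> times the derivative of \<open>p\<close> in direction \<open>b\<close> up to \<open>o(h)\<close>, uniformly in \<open>t\<close>.
\<close>

lemma second_difference_quotient:
  assumes "open \<Omega>" "z \<in> \<Omega>" "\<And>w. w \<in> \<Omega> \<Longrightarrow> f differentiable (at w)"
    and "pderiv_dir a f differentiable (at z)"
  shows "((\<lambda>h. (f (z + of_real h * a + of_real h * b) - f (z + of_real h * a) - f (z + of_real h * b) + f z)
            / (of_real h)\<^sup>2) \<longlongrightarrow> pderiv_dir b (pderiv_dir a f) z) (at_right 0)"
proof (rule tendstoI)
  fix e :: real assume "e > 0"
  define N where "N = cmod a + cmod b + 1"
  have "N > 0" unfolding N_def by (simp add: add_nonneg_pos)
  let ?p = "pderiv_dir a f" and ?p' = "frechet_derivative (pderiv_dir a f) (at z)"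
  have p': "(?p has_derivative ?p') (at z)" using assms(4) by (simp add: frechet_derivative_works)
  then interpret p': bounded_linear ?p' by (rule has_derivative_bounded_linear)
  obtain d where d: "d > 0" "\<And>w. cmod (w - z) < d \<Longrightarrow>
      cmod (?p w - ?p z - ?p' (w - z)) \<le> e / (4 * N) * cmod (w - z)"
    using p'[unfolded has_derivative_at_alt, THEN conjunct2, rule_format, of "e / (4 * N)"] \<open>e > 0\<close> \<open>N > 0\<close>
    by auto
  obtain r where r: "r > 0" "ball z r \<subseteq> \<Omega>" using assms(1,2) openE by blast
  define \<rho> where "\<rho> = min d r / N"
  have "\<rho> > 0" using d r \<open>N > 0\<close> by (simp add: \<rho>_def)
  then have ev: "\<forall>\<^sub>F h in at_right (0::real). 0 < h \<and> h < \<rho>"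
    by (intro eventually_at_rightI[of 0 \<rho>]) auto
  then show "\<forall>\<^sub>F h in at_right 0. dist ((f (z + of_real h * a + of_real h * b) - f (z + of_real h * a)
      - f (z + of_real h * b) + f z) / (of_real h)\<^sup>2) (pderiv_dir b ?p z) < e"
  proof eventually_elim
    case (elim h)
    \<comment> \<open>the increment minus its expected linear part; its derivative is at most \<open>e h / 2\<close>\<close>
    define \<psi> where "\<psi> = (\<lambda>t. f (z + of_real t * a + of_real h * b) - f (z + of_real t * a) - of_real (t * h) * ?p' b)"
    have near: "cmod (of_real t * a + of_real s * b) \<le> h * N \<and> h * N < min d r"
      if "0 \<le> t" "t \<le> h" "0 \<le> s" "s \<le> h" for t s
    proof -
      have "cmod (of_real t * a + of_real s * b) \<le> t * cmod a + s * cmod b"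
        using norm_triangle_ineq[of "of_real t * a" "of_real s * b"] that by (simp add: norm_mult)
      also have "\<dots> \<le> h * cmod a + h * cmod b" using that by (intro add_mono mult_right_mono) auto
      also have "\<dots> \<le> h * N" using elim by (simp add: N_def algebra_simps)
      finally show ?thesis using elim \<open>N > 0\<close> by (simp add: \<rho>_def field_simps)
    qed
    have in\<Omega>: "z + of_real t * a + of_real s * b \<in> \<Omega>" if "0 \<le> t" "t \<le> h" "0 \<le> s" "s \<le> h" for t s
    proof -
      have "dist z (z + of_real t * a + of_real s * b) = cmod (of_real t * a + of_real s * b)"
        by (simp add: dist_norm add.assoc norm_minus_commute norm_minus_cancel[of "of_real t * a + of_real s * b", symmetric] del: norm_minus_cancel)
      then show ?thesis using near[OF that] r by (force simp: mem_ball)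
    qed
    have est: "cmod (?p (z + of_real t * a + of_real s * b) - ?p z - ?p' (of_real t * a + of_real s * b)) \<le> e / 4 * h"
      if "0 \<le> t" "t \<le> h" "0 \<le> s" "s \<le> h" for t s
    proof -
      have "cmod (?p (z + of_real t * a + of_real s * b) - ?p z - ?p' (of_real t * a + of_real s * b))
          \<le> e / (4 * N) * cmod (of_real t * a + of_real s * b)"
        using d(2)[of "z + of_real t * a + of_real s * b"] near[OF that] by (simp add: add.assoc)
      also have "\<dots> \<le> e / (4 * N) * (h * N)"
        using near[OF that] \<open>e > 0\<close> \<open>N > 0\<close> by (intro mult_left_mono) auto
      finally show ?thesis using \<open>N > 0\<close> by simp
    qed
    have der: "(\<psi> has_vector_derivative ?p (z + of_real t * a + of_real h * b) - ?p (z + of_real t * a) - of_real h * ?p' b) (at t)"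
      if "0 \<le> t" "t \<le> h" for t
    proof -
      have D: "((\<lambda>t. f (z + of_real t * a + of_real s * b)) has_vector_derivative ?p (z + of_real t * a + of_real s * b)) (at t)"
        if "0 \<le> s" "s \<le> h" for s
      proof -
        have dif: "f differentiable (at (z + of_real t * a + of_real s * b))"
          by (intro assms(3) in\<Omega> \<open>0 \<le> t\<close> \<open>t \<le> h\<close> that)
        have "((\<lambda>t. z + of_real t * a + of_real s * b) has_vector_derivative a) (at t)"
          by (auto intro!: derivative_eq_intros)
        from has_vector_derivative_wirtinger[OF dif this] show ?thesis
          by (simp add: pderiv_dir_wirtinger[OF dif])
      qed
      have "((\<lambda>t. of_real (t * h) * ?p' b) has_vector_derivative of_real h * ?p' b) (at t)"
        by (auto intro!: derivative_eq_intros)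
      from has_vector_derivative_diff[OF has_vector_derivative_diff[OF D[of h] D[of 0]] this]
      show ?thesis using elim by (simp add: \<psi>_def)
    qed
    have "cmod (\<psi> h - \<psi> 0) \<le> e / 2 * h * h - e / 2 * h * 0"
    proof (rule differentiable_bound_general[where f' = "\<lambda>t. ?p (z + of_real t * a + of_real h * b) - ?p (z + of_real t * a) - of_real h * ?p' b"
          and \<phi> = "\<lambda>t. e / 2 * h * t" and \<phi>' = "\<lambda>t. e / 2 * h"])
      show "continuous_on {0..h} \<psi>"
        by (intro continuous_at_imp_continuous_on ballI has_vector_derivative_continuous[OF der]) auto
      show "cmod (?p (z + of_real t * a + of_real h * b) - ?p (z + of_real t * a) - of_real h * ?p' b) \<le> e / 2 * h"
        if t: "0 < t" "t < h" for t
      proof -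
        have "?p (z + of_real t * a + of_real h * b) - ?p (z + of_real t * a) - of_real h * ?p' b
          = (?p (z + of_real t * a + of_real h * b) - ?p z - ?p' (of_real t * a + of_real h * b))
            - (?p (z + of_real t * a + of_real 0 * b) - ?p z - ?p' (of_real t * a + of_real 0 * b))"
          using p'.scaleR[of h b] by (simp add: p'.add scaleR_conv_of_real)
        also have "cmod \<dots> \<le> e / 4 * h + e / 4 * h"
          by (rule order_trans[OF norm_triangle_ineq4]) (intro add_mono est; use t in simp)
        finally show ?thesis by simp
      qed
    qed (use elim der in \<open>auto intro!: continuous_intros derivative_eq_intros\<close>)
    moreover have "\<psi> h - \<psi> 0 = f (z + of_real h * a + of_real h * b) - f (z + of_real h * a)
        - f (z + of_real h * b) + f z - of_real h * of_real h * ?p' b" by (simp add: \<psi>_def)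
    ultimately have "cmod (f (z + of_real h * a + of_real h * b) - f (z + of_real h * a)
        - f (z + of_real h * b) + f z - of_real h * of_real h * ?p' b) \<le> e / 2 * h\<^sup>2"
      by (simp add: power2_eq_square)
    moreover define Q where "Q = f (z + of_real h * a + of_real h * b) - f (z + of_real h * a)
        - f (z + of_real h * b) + f z"
    ultimately have "cmod (Q - (of_real h)\<^sup>2 * ?p' b) / h\<^sup>2 \<le> e / 2"
      using elim by (simp only: power2_eq_square) (simp add: pos_divide_le_eq)
    moreover have "Q / (of_real h)\<^sup>2 - ?p' b = (Q - (of_real h)\<^sup>2 * ?p' b) / (of_real h)\<^sup>2"
      using elim by (simp add: diff_divide_distrib)
    ultimately have "cmod (Q / (of_real h)\<^sup>2 - ?p' b) \<le> e / 2"
      by (simp add: norm_divide norm_power)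
    then show ?case using \<open>e > 0\<close> by (simp add: dist_norm Q_def pderiv_dir_def)
  qed
qed

lemma pderiv_dir_commute:
  assumes "open \<Omega>" "z \<in> \<Omega>" "\<And>w. w \<in> \<Omega> \<Longrightarrow> f differentiable (at w)"
    and "pderiv_dir a f differentiable (at z)" "pderiv_dir b f differentiable (at z)"
  shows "pderiv_dir a (pderiv_dir b f) z = pderiv_dir b (pderiv_dir a f) z"
proof (rule tendsto_unique[OF _ second_difference_quotient[of \<Omega>]])
  show "((\<lambda>h. (f (z + of_real h * b + of_real h * a) - f (z + of_real h * b) - f (z + of_real h * a) + f z)
            / (of_real h)\<^sup>2) \<longlongrightarrow> pderiv_dir b (pderiv_dir a f) z) (at_right 0)"
    using second_difference_quotient[OF assms(1-4), of b] by (simp add: algebra_simps)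
qed (use assms in auto)

section \<open>A Cauchy estimate for nearly holomorphic functions\<close>

text \<open>
  Differentiation under the integral sign with respect to the radius. The weight \<open>c\<close> is \<open>1\<close> for mean
  values and \<open>e\<^bsup>-i\<theta>\<^esup>\<close> for the first Fourier coefficient.
\<close>

lemma circle_integral_has_vector_derivative:
  fixes c :: "real \<Rightarrow> complex"
  assumes diff: "\<And>w. w \<in> cball z r \<Longrightarrow> G differentiable (at w)"
    and cont: "continuous_on (cball z r) (dz G)" "continuous_on (cball z r) (dbar G)"
    and c: "continuous_on {0..2*pi} c" and t: "0 \<le> t" "t \<le> r"
  shows "((\<lambda>t. integral {0..2*pi} (\<lambda>\<theta>. c \<theta> * G (z + of_real t * cis \<theta>))) has_vector_derivative
     integral {0..2*pi} (\<lambda>\<theta>. c \<theta> * (cis \<theta> * dz G (z + of_real t * cis \<theta>)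
        + cis (- \<theta>) * dbar G (z + of_real t * cis \<theta>)))) (at t within {0..r})"
proof -
  have inb: "z + of_real t * cis \<theta> \<in> cball z r" if "0 \<le> t" "t \<le> r" for t \<theta>
    using that by (simp add: dist_norm norm_mult)
  have contG: "continuous_on (cball z r) G"
    by (intro continuous_at_imp_continuous_on ballI differentiable_imp_continuous_within diff)
  have "((\<lambda>t. integral (cbox 0 (2*pi)) (\<lambda>\<theta>. c \<theta> * G (z + of_real t * cis \<theta>))) has_vector_derivative
     integral (cbox 0 (2*pi)) (\<lambda>\<theta>. c \<theta> * (cis \<theta> * dz G (z + of_real t * cis \<theta>)
        + cis (- \<theta>) * dbar G (z + of_real t * cis \<theta>)))) (at t within {0..r})"
  proof (rule leibniz_rule_vector_derivative)
    fix x \<theta> assume "x \<in> {0..r}" "\<theta> \<in> cbox 0 (2*pi)"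
    then have d: "G differentiable (at (z + of_real x * cis \<theta>))" by (intro diff inb) auto
    have "((\<lambda>t. z + of_real t * cis \<theta>) has_vector_derivative cis \<theta>) (at x within {0..r})"
      by (auto intro!: derivative_eq_intros)
    from has_vector_derivative_wirtinger[OF d this]
    show "((\<lambda>x. c \<theta> * G (z + of_real x * cis \<theta>)) has_vector_derivative
        c \<theta> * (cis \<theta> * dz G (z + of_real x * cis \<theta>) + cis (- \<theta>) * dbar G (z + of_real x * cis \<theta>)))
        (at x within {0..r})"
      by (intro has_vector_derivative_mult_right) (simp add: cis_cnj)
  next
    fix x assume "x \<in> {0..r}"
    then show "(\<lambda>\<theta>. c \<theta> * G (z + of_real x * cis \<theta>)) integrable_on cbox 0 (2*pi)"
      using c by (intro integrable_continuous continuous_intros continuous_on_compose2[OF contG]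
          continuous_on_cis) (auto simp: inb dist_norm norm_mult)
  next
    have c': "continuous_on ({0..r} \<times> cbox 0 (2*pi)) (\<lambda>(x, \<theta>). c \<theta>)"
      unfolding split_beta using c by (intro continuous_on_compose2[OF c] continuous_intros) auto
    show "continuous_on ({0..r} \<times> cbox 0 (2*pi)) (\<lambda>(x, \<theta>). c \<theta> * (cis \<theta> * dz G (z + of_real x * cis \<theta>)
        + cis (- \<theta>) * dbar G (z + of_real x * cis \<theta>)))"
      using c' unfolding split_beta
      by (intro continuous_intros continuous_on_compose2[OF cont(1)] continuous_on_compose2[OF cont(2)]
          continuous_on_cis) (auto simp: dist_norm norm_mult)
  qed (use t in auto)
  then show ?thesis by simp
qed

lemma cis_has_vector_derivative: "(cis has_vector_derivative \<i> * cis x) (at x within T)"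
proof -
  have "((\<lambda>w. exp (\<i> * w)) has_field_derivative \<i> * exp (\<i> * of_real x)) (at (of_real x))"
    by (auto intro!: derivative_eq_intros)
  from has_vector_derivative_real_field[OF this] show ?thesis
    by (simp only: cis_conv_exp[abs_def])
qed

lemma integral_cis_period: "integral {0..2*pi} (\<lambda>\<theta>. cis (- \<theta>)) = 0"
proof -
  have "(cis has_integral (- \<i> * cis (2 * pi) - - \<i> * cis 0)) {0..2*pi}"
  proof (rule fundamental_theorem_of_calculus)
    fix x :: real
    show "((\<lambda>\<theta>. - \<i> * cis \<theta>) has_vector_derivative cis x) (at x within {0..2*pi})"
      using has_vector_derivative_mult_right[OF cis_has_vector_derivative[of x], of "- \<i>"] by simp
  qed simp
  then have "integral {0..2*pi} cis = 0" by (intro integral_unique) simp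
  then show ?thesis using integral_cnj[of "{0..2*pi}" cis] by (simp add: cis_cnj)
qed

lemma circle_integral_bound:
  assumes "continuous_on {0..2*pi} f" "\<And>\<theta>. cmod (f \<theta>) \<le> B"
  shows "cmod (integral {0..2*pi} f) \<le> 2 * pi * B"
proof -
  have "cmod (integral {0..2*pi} f) \<le> B * (2 * pi - 0)"
    by (rule integral_bound) (use assms in auto)
  then show ?thesis by (simp add: mult.commute)
qed

lemma continuous_on_circle:
  assumes "continuous_on (cball z r) g" "0 \<le> t" "t \<le> r"
  shows "continuous_on S (\<lambda>\<theta>. g (z + of_real t * cis \<theta>))"
  by (rule continuous_on_compose2[OF assms(1)])
     (use assms in \<open>auto intro!: continuous_intros continuous_on_cis simp: dist_norm norm_mult\<close>)

text \<open>
  The mean value property, up to an error controlled by \<open>dbar G\<close>. The radial derivative of the circle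
  integral is the integral of \<open>e\<^bsup>i\<theta>\<^esup> dz G + e\<^bsup>-i\<theta>\<^esup> dbar G\<close>. The derivative of \<open>G\<close> along the circle, a
  multiple of \<open>e\<^bsup>i\<theta>\<^esup> dz G - e\<^bsup>-i\<theta>\<^esup> dbar G\<close>, integrates to zero by periodicity, so the
  radial derivative equals the integral of \<open>2 e\<^bsup>-i\<theta>\<^esup> dbar G\<close>.
\<close>

lemma circle_mean_value_dbar:
  assumes diff: "\<And>w. w \<in> cball z r \<Longrightarrow> G differentiable (at w)"
    and cont: "continuous_on (cball z r) (dz G)" "continuous_on (cball z r) (dbar G)"
    and bound: "\<And>w. w \<in> cball z r \<Longrightarrow> cmod (dbar G w) \<le> \<eta>" and t: "0 < t" "t \<le> r"
  shows "cmod (integral {0..2*pi} (\<lambda>\<theta>. G (z + of_real t * cis \<theta>)) - of_real (2 * pi) * G z)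
    \<le> 4 * pi * \<eta> * t"
proof -
  define F where "F = (\<lambda>t. integral {0..2*pi} (\<lambda>\<theta>. G (z + of_real t * cis \<theta>)))"
  let ?F' = "\<lambda>s. integral {0..2*pi} (\<lambda>\<theta>. cis \<theta> * dz G (z + of_real s * cis \<theta>)
        + cis (- \<theta>) * dbar G (z + of_real s * cis \<theta>))"
  have F: "(F has_vector_derivative ?F' s) (at s within {0..r})" if "0 \<le> s" "s \<le> r" for s
    using circle_integral_has_vector_derivative[OF diff cont continuous_on_const that, of 1]
    by (simp add: F_def)
  have bF': "cmod (?F' s) \<le> 4 * pi * \<eta>" if s: "0 < s" "s \<le> r" for s
  proof -
    have inb: "z + of_real s * cis \<theta> \<in> cball z r" for \<theta>
      using s by (simp add: dist_norm norm_mult)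
    note conts = continuous_on_circle[OF cont(1), of s "{0..2*pi}"] continuous_on_circle[OF cont(2), of s "{0..2*pi}"]
    have ccis: "continuous_on {0..2*pi} (\<lambda>\<theta>. cis (- \<theta>))" "continuous_on {0..2*pi} cis"
      by (intro continuous_on_cis continuous_intros)+
    have "((\<lambda>\<theta>. \<i> * of_real s * (cis \<theta> * dz G (z + of_real s * cis \<theta>) - cis (- \<theta>) * dbar G (z + of_real s * cis \<theta>)))
        has_integral G (z + of_real s * cis (2 * pi)) - G (z + of_real s * cis 0)) {0..2*pi}"
    proof (rule fundamental_theorem_of_calculus)
      fix \<theta> :: real
      have "((\<lambda>\<theta>. z + of_real s * cis \<theta>) has_vector_derivative of_real s * (\<i> * cis \<theta>)) (at \<theta> within {0..2*pi})"
        using has_vector_derivative_add[OF has_vector_derivative_const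
            has_vector_derivative_mult_right[OF cis_has_vector_derivative]] by simp
      note D = has_vector_derivative_wirtinger[where g = G, OF diff[OF inb[of \<theta>]] this]
      have "of_real s * (j * c) * A + of_real s * (- j * d) * B = j * of_real s * (c * A - d * B)"
        for j c d A B :: complex by (simp add: algebra_simps)
      from this[of \<i> "cis \<theta>" "dz G (z + of_real s * cis \<theta>)" "cis (- \<theta>)" "dbar G (z + of_real s * cis \<theta>)"] D
      show "((\<lambda>\<theta>. G (z + of_real s * cis \<theta>)) has_vector_derivative \<i> * of_real s *
          (cis \<theta> * dz G (z + of_real s * cis \<theta>) - cis (- \<theta>) * dbar G (z + of_real s * cis \<theta>))) (at \<theta> within {0..2*pi})"
        by (simp only: complex_cnj_mult complex_cnj_complex_of_real complex_cnj_i cis_cnj)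
    qed simp
    then have "integral {0..2*pi} (\<lambda>\<theta>. \<i> * of_real s * (cis \<theta> * dz G (z + of_real s * cis \<theta>) - cis (- \<theta>) * dbar G (z + of_real s * cis \<theta>))) = 0"
      by (intro integral_unique) simp
    \<comment> \<open>\<open>s > 0\<close> permits cancelling the factor \<open>\<i> s\<close>\<close>
    then have zero: "integral {0..2*pi} (\<lambda>\<theta>. cis \<theta> * dz G (z + of_real s * cis \<theta>) - cis (- \<theta>) * dbar G (z + of_real s * cis \<theta>)) = 0"
      using s by (subst (asm) integral_mult_right) simp
    have "?F' s = integral {0..2*pi} (\<lambda>\<theta>. (cis \<theta> * dz G (z + of_real s * cis \<theta>) - cis (- \<theta>) * dbar G (z + of_real s * cis \<theta>))
        + 2 * (cis (- \<theta>) * dbar G (z + of_real s * cis \<theta>)))"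
      by (rule integral_cong) simp
    also have "\<dots> = 0 + integral {0..2*pi} (\<lambda>\<theta>. 2 * (cis (- \<theta>) * dbar G (z + of_real s * cis \<theta>)))"
      unfolding zero[symmetric]
      by (intro integral_add integrable_continuous_real continuous_intros conts ccis) (use s in auto)
    also have "cmod \<dots> \<le> 2 * pi * (2 * \<eta>)"
      unfolding add_0
      by (intro circle_integral_bound continuous_intros conts ccis)
         (use s inb bound in \<open>auto simp: norm_mult\<close>)
    finally show ?thesis by simp
  qed
  have "cmod (F t - F 0) \<le> 4 * pi * \<eta> * t - 4 * pi * \<eta> * 0"
  proof (rule differentiable_bound_general[where f' = ?F' and \<phi> = "\<lambda>t. 4 * pi * \<eta> * t" and \<phi>' = "\<lambda>_. 4 * pi * \<eta>"])
    have "continuous_on {0..r} F"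
      unfolding continuous_on_eq_continuous_within
      by (intro ballI has_vector_derivative_continuous[OF F]) auto
    then show "continuous_on {0..t} F" by (rule continuous_on_subset) (use t in auto)
    show "(F has_vector_derivative ?F' s) (at s)" if "0 < s" "s < t" for s
      using F[of s] that t at_within_Icc_at[of 0 s r] by simp
    show "cmod (?F' s) \<le> 4 * pi * \<eta>" if "0 < s" "s < t" for s
      by (rule bF') (use that t in auto)
  qed (use t in \<open>auto intro!: continuous_intros derivative_eq_intros\<close>)
  moreover have "F 0 = of_real (2 * pi) * G z" by (simp add: F_def scaleR_conv_of_real)
  ultimately show ?thesis by (simp add: F_def)
qed

text \<open>
  The first Fourier coefficient \<open>F t\<close> of \<open>G\<close> on the circle of radius \<open>t\<close> vanishes for \<open>t = 0\<close>. Its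
  derivative is the circle integral of \<open>dz G\<close> up to \<open>2 \<pi> \<eta>\<close>, and thus close to \<open>2 \<pi> dz G z\<close> by the
  approximate mean value property of \<open>dz G\<close>. Hence \<open>F r\<close>, which is at most \<open>2 \<pi> M\<close>, is close to
  \<open>2 \<pi> r dz G z\<close>. In contrast to Cauchy's formula with its kernel, nothing is singular at the centre.
\<close>

lemma cauchy_estimate_dbar:
  assumes diff: "\<And>w. w \<in> cball z r \<Longrightarrow> G differentiable (at w)"
      "\<And>w. w \<in> cball z r \<Longrightarrow> dz G differentiable (at w)"
    and cont: "continuous_on (cball z r) (dbar G)" "continuous_on (cball z r) (dz (dz G))"
      "continuous_on (cball z r) (dbar (dz G))"
    and bound: "\<And>w. w \<in> cball z r \<Longrightarrow> cmod (dbar G w) \<le> \<eta>"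
      "\<And>w. w \<in> cball z r \<Longrightarrow> cmod (dbar (dz G) w) \<le> \<eta>"
      "\<And>w. w \<in> cball z r \<Longrightarrow> cmod (G w) \<le> M"
    and r: "0 < r"
  shows "r * cmod (dz G z) \<le> M + (2 * r + 1) * r * \<eta>"
proof -
  have contdz: "continuous_on (cball z r) (dz G)" and contG: "continuous_on (cball z r) G"
    by (intro continuous_at_imp_continuous_on ballI differentiable_imp_continuous_within diff; assumption)+
  have ccis: "continuous_on S (\<lambda>\<theta>. cis (- \<theta>))" for S :: "real set"
    by (intro continuous_on_cis continuous_intros)
  have "\<eta> \<ge> 0" using bound(1)[of z] r norm_ge_zero[of "dbar G z"] by (simp del: norm_ge_zero)
  have inb: "z + of_real s * cis \<theta> \<in> cball z r" if "0 \<le> s" "s \<le> r" for s \<theta>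
    using that by (simp add: dist_norm norm_mult)
  define F where "F = (\<lambda>t. integral {0..2*pi} (\<lambda>\<theta>. cis (- \<theta>) * G (z + of_real t * cis \<theta>)))"
  define H where "H = (\<lambda>t. F t - of_real t * (of_real (2 * pi) * dz G z))"
  let ?I = "\<lambda>s. integral {0..2*pi} (\<lambda>\<theta>. dz G (z + of_real s * cis \<theta>))"
  let ?J = "\<lambda>s. integral {0..2*pi} (\<lambda>\<theta>. cis (- \<theta>) * (cis (- \<theta>) * dbar G (z + of_real s * cis \<theta>)))"
  have F: "(F has_vector_derivative ?I s + ?J s) (at s within {0..r})" if s: "0 \<le> s" "s \<le> r" for s
  proof -
    have "integral {0..2*pi} (\<lambda>\<theta>. cis (- \<theta>) * (cis \<theta> * dz G (z + of_real s * cis \<theta>)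
        + cis (- \<theta>) * dbar G (z + of_real s * cis \<theta>)))
      = integral {0..2*pi} (\<lambda>\<theta>. dz G (z + of_real s * cis \<theta>)
        + cis (- \<theta>) * (cis (- \<theta>) * dbar G (z + of_real s * cis \<theta>)))"
      by (rule integral_cong) (simp add: distrib_left mult.assoc[symmetric] cis_mult)
    also have "\<dots> = ?I s + ?J s"
      by (intro integral_add integrable_continuous_real continuous_intros ccis
          continuous_on_circle[OF contdz] continuous_on_circle[OF cont(1)] s)
    finally show ?thesis
      using circle_integral_has_vector_derivative[OF diff(1) contdz cont(1) ccis s]
      by (simp add: F_def)
  qed
  have H: "(H has_vector_derivative ?I s + ?J s - of_real (2 * pi) * dz G z) (at s within {0..r})"
    if s: "0 \<le> s" "s \<le> r" for s
    unfolding H_def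
    by (intro has_vector_derivative_diff F s) (auto intro!: derivative_eq_intros)
  let ?B = "(4 * pi * r + 2 * pi) * \<eta>"
  have "cmod (H r - H 0) \<le> ?B * r - ?B * 0"
  proof (rule differentiable_bound_general[where f' = "\<lambda>s. ?I s + ?J s - of_real (2 * pi) * dz G z"
        and \<phi> = "\<lambda>t. ?B * t" and \<phi>' = "\<lambda>_. ?B"])
    show "continuous_on {0..r} H"
      unfolding continuous_on_eq_continuous_within
      by (intro ballI has_vector_derivative_continuous[OF H]) auto
    show "(H has_vector_derivative ?I s + ?J s - of_real (2 * pi) * dz G z) (at s)" if "0 < s" "s < r" for s
      using H[of s] that at_within_Icc_at[of 0 s r] by simp
    show "cmod (?I s + ?J s - of_real (2 * pi) * dz G z) \<le> ?B" if s: "0 < s" "s < r" for s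
    proof -
      have "cmod (?I s + ?J s - of_real (2 * pi) * dz G z) \<le> cmod (?I s - of_real (2 * pi) * dz G z) + cmod (?J s)"
        using norm_triangle_ineq[of "?I s - of_real (2 * pi) * dz G z" "?J s"] by (simp add: algebra_simps)
      also have "cmod (?I s - of_real (2 * pi) * dz G z) \<le> 4 * pi * \<eta> * s"
        by (rule circle_mean_value_dbar[OF diff(2) cont(2,3) bound(2)]) (use s in auto)
      also have "4 * pi * \<eta> * s \<le> 4 * pi * \<eta> * r"
        using s \<open>\<eta> \<ge> 0\<close> by (intro mult_left_mono) auto
      also have "cmod (?J s) \<le> 2 * pi * \<eta>"
        by (intro circle_integral_bound continuous_intros ccis continuous_on_circle[OF cont(1)])
           (use s inb bound(1) in \<open>auto simp: norm_mult\<close>)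
      finally show ?thesis by (simp add: algebra_simps)
    qed
  qed (use r in \<open>auto intro!: continuous_intros derivative_eq_intros\<close>)
  moreover have "H 0 = 0"
    using integral_cis_period by (simp add: H_def F_def)
  ultimately have 1: "cmod (F r - of_real r * (of_real (2 * pi) * dz G z)) \<le> ?B * r"
    by (simp add: H_def)
  have 2: "cmod (F r) \<le> 2 * pi * M"
    unfolding F_def
    by (intro circle_integral_bound continuous_intros ccis continuous_on_circle[OF contG])
       (use r inb bound(3) in \<open>auto simp: norm_mult\<close>)
  have "2 * pi * (r * cmod (dz G z)) = cmod (of_real r * (of_real (2 * pi) * dz G z))"
    using r by (simp add: norm_mult)
  also have "\<dots> \<le> cmod (F r) + cmod (F r - of_real r * (of_real (2 * pi) * dz G z))"
    using norm_triangle_sub[of "of_real r * (of_real (2 * pi) * dz G z)" "F r"] by (simp add: norm_minus_commute)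
  also have "\<dots> \<le> 2 * pi * (M + (2 * r + 1) * r * \<eta>)"
    using 1 2 by (simp add: algebra_simps)
  finally show ?thesis by simp
qed

section \<open>Estimates of nets on families of sets\<close>

text \<open>
  The set may depend on \<open>\<epsilon>\<close> because the final estimates concern discs of radius \<open>\<epsilon>\<^sup>a\<close>, and it may be
  empty for some \<open>\<epsilon>\<close>, which expresses estimates along a set of parameters.
\<close>

definition bigo_on :: "(real \<Rightarrow> complex set) \<Rightarrow> (real \<Rightarrow> complex \<Rightarrow> complex) \<Rightarrow> real \<Rightarrow> bool" where
  "bigo_on L u p \<longleftrightarrow> (\<exists>C. \<forall>\<^sub>F \<epsilon> in at_right 0. \<forall>w\<in>L \<epsilon>. cmod (u \<epsilon> w) \<le> C * \<epsilon> powr p)"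

lemma bigo_onE:
  assumes "bigo_on L u p"
  obtains C where "C \<ge> 0" "\<forall>\<^sub>F \<epsilon> in at_right 0. \<forall>w\<in>L \<epsilon>. cmod (u \<epsilon> w) \<le> C * \<epsilon> powr p"
proof -
  obtain C where C: "\<forall>\<^sub>F \<epsilon> in at_right 0. \<forall>w\<in>L \<epsilon>. cmod (u \<epsilon> w) \<le> C * \<epsilon> powr p"
    using assms by (auto simp: bigo_on_def)
  then have "\<forall>\<^sub>F \<epsilon> in at_right 0. \<forall>w\<in>L \<epsilon>. cmod (u \<epsilon> w) \<le> \<bar>C\<bar> * \<epsilon> powr p"
  proof eventually_elim
    case (elim \<epsilon>)
    have "C * \<epsilon> powr p \<le> \<bar>C\<bar> * \<epsilon> powr p" by (intro mult_right_mono) auto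
    with elim show ?case by fastforce
  qed
  then show ?thesis using that[of "\<bar>C\<bar>"] by simp
qed

lemma bigo_on_subset:
  assumes "bigo_on L' u p" "\<forall>\<^sub>F \<epsilon> in at_right 0. L \<epsilon> \<subseteq> L' \<epsilon>"
  shows "bigo_on L u p"
proof -
  obtain C where "\<forall>\<^sub>F \<epsilon> in at_right 0. \<forall>w\<in>L' \<epsilon>. cmod (u \<epsilon> w) \<le> C * \<epsilon> powr p"
    using assms(1) by (auto simp: bigo_on_def)
  then have "\<forall>\<^sub>F \<epsilon> in at_right 0. \<forall>w\<in>L \<epsilon>. cmod (u \<epsilon> w) \<le> C * \<epsilon> powr p"
    using assms(2) by eventually_elim blast
  then show ?thesis by (auto simp: bigo_on_def)
qed

lemma bigo_on_mono:
  assumes "bigo_on L u p" "q \<le> p"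
  shows "bigo_on L u q"
proof -
  obtain C where "C \<ge> 0" "\<forall>\<^sub>F \<epsilon> in at_right 0. \<forall>w\<in>L \<epsilon>. cmod (u \<epsilon> w) \<le> C * \<epsilon> powr p"
    using assms(1) by (rule bigo_onE)
  from ev01 this(2) have "\<forall>\<^sub>F \<epsilon> in at_right 0. \<forall>w\<in>L \<epsilon>. cmod (u \<epsilon> w) \<le> C * \<epsilon> powr q"
  proof eventually_elim
    case (elim \<epsilon>)
    have "C * \<epsilon> powr p \<le> C * \<epsilon> powr q"
      using elim assms(2) \<open>C \<ge> 0\<close> by (intro mult_left_mono powr_mono') auto
    with elim show ?case by fastforce
  qed
  then show ?thesis by (auto simp: bigo_on_def)
qed

lemma bigo_on_add:
  assumes "bigo_on L u p" "bigo_on L v p"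
  shows "bigo_on L (\<lambda>\<epsilon> w. u \<epsilon> w + v \<epsilon> w) p"
proof -
  obtain C D where "\<forall>\<^sub>F \<epsilon> in at_right 0. \<forall>w\<in>L \<epsilon>. cmod (u \<epsilon> w) \<le> C * \<epsilon> powr p"
    "\<forall>\<^sub>F \<epsilon> in at_right 0. \<forall>w\<in>L \<epsilon>. cmod (v \<epsilon> w) \<le> D * \<epsilon> powr p"
    using assms unfolding bigo_on_def by blast
  then have "\<forall>\<^sub>F \<epsilon> in at_right 0. \<forall>w\<in>L \<epsilon>. cmod (u \<epsilon> w + v \<epsilon> w) \<le> (C + D) * \<epsilon> powr p"
    by eventually_elim (auto simp: distrib_right intro!: norm_triangle_le add_mono)
  then show ?thesis by (auto simp: bigo_on_def)
qed

lemma colombeau_moderate_bigo_on: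
  assumes "u \<in> colombeau_moderate \<Omega>" "compact K" "K \<subseteq> \<Omega>"
  shows "\<exists>p. bigo_on (\<lambda>_. K) u p"
proof (cases "K = {}")
  case False
  then obtain N C where "\<forall>\<^sub>F \<epsilon> in at_right 0. \<forall>z\<in>K. cmod (partial_deriv [] (u \<epsilon>) z) \<le> C * norm (1 / \<epsilon> ^ N)"
    using colombeau_moderate_bound[OF assms(1), of K "[]"] assms by auto
  with ev01 have "\<forall>\<^sub>F \<epsilon> in at_right 0. \<forall>w\<in>K. cmod (u \<epsilon> w) \<le> C * \<epsilon> powr (- real N)"
    by eventually_elim (simp add: powr_minus powr_realpow divide_inverse)
  then show ?thesis unfolding bigo_on_def by blast
qed (simp add: bigo_on_def)

lemma colombeau_null_bigo_on:
  assumes "u \<in> colombeau_null \<Omega>" "compact K" "K \<subseteq> \<Omega>"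
  shows "bigo_on (\<lambda>_. K) u p"
proof (cases "K = {}")
  case False
  obtain m where m: "p \<le> real m" using real_arch_simple by blast
  obtain C where "\<forall>\<^sub>F \<epsilon> in at_right 0. \<forall>z\<in>K. cmod (partial_deriv [] (u \<epsilon>) z) \<le> C * norm (\<epsilon> ^ m)"
    using colombeau_null_bound[OF assms(1), of K "[]" m] assms False by auto
  with ev01 have "\<forall>\<^sub>F \<epsilon> in at_right 0. \<forall>w\<in>K. cmod (u \<epsilon> w) \<le> C * \<epsilon> powr real m"
    by eventually_elim (simp add: powr_realpow)
  then have "bigo_on (\<lambda>_. K) u (real m)" unfolding bigo_on_def by blast
  then show ?thesis using m by (rule bigo_on_mono)
qed (simp add: bigo_on_def)

lemma null_imp_eventually_le:
  assumes "null x"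
  shows "\<forall>\<^sub>F \<epsilon> in at_right 0. cmod (x \<epsilon>) \<le> \<epsilon> powr p"
proof -
  have "((\<lambda>\<epsilon>. cmod (x \<epsilon>) / \<epsilon> powr p) \<longlongrightarrow> 0) (at_right 0)"
    using assms by (simp add: null_def decays_def)
  then have "\<forall>\<^sub>F \<epsilon> in at_right 0. cmod (x \<epsilon>) / \<epsilon> powr p < 1" by (rule order_tendstoD(2)) simp
  with ev01 show ?thesis by eventually_elim (simp add: pos_divide_less_eq)
qed

section \<open>Derivatives of generalized holomorphic functions\<close>

definition asymp_holomorphic :: "complex set \<Rightarrow> (real \<Rightarrow> complex \<Rightarrow> complex) \<Rightarrow> bool" where
  "asymp_holomorphic \<Omega> u \<longleftrightarrow> u \<in> colombeau_moderate \<Omega> \<and> (\<lambda>\<epsilon>. dbar (u \<epsilon>)) \<in> colombeau_null \<Omega>"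

lemma dz_lincomb: "dz g = (\<lambda>z. 1/2 * pderiv_dir 1 g z + (-\<i>/2) * pderiv_dir \<i> g z)"
  by (rule ext) (simp add: dz_def field_simps)

lemma dbar_lincomb: "dbar g = (\<lambda>z. 1/2 * pderiv_dir 1 g z + (\<i>/2) * pderiv_dir \<i> g z)"
  by (rule ext) (simp add: dbar_def field_simps)

lemma colombeau_null_dz:
  assumes "open \<Omega>" "u \<in> colombeau_null \<Omega>"
  shows "(\<lambda>\<epsilon>. dz (u \<epsilon>)) \<in> colombeau_null \<Omega>"
  unfolding dz_lincomb using assms by (intro colombeau_null_lincomb colombeau_null_pderiv) auto

lemma dbar_dz_commute:
  assumes "open \<Omega>" "z \<in> \<Omega>" "smooth_on \<Omega> g"
  shows "dbar (dz g) z = dz (dbar g) z"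
proof -
  have sm: "smooth_on \<Omega> (pderiv_dir 1 g)" "smooth_on \<Omega> (pderiv_dir \<i> g)"
    using assms(3) by (auto intro: smooth_on_pderiv)
  have D: "pderiv_dir v (\<lambda>z. a * pderiv_dir 1 g z + b * pderiv_dir \<i> g z) z
      = a * pderiv_dir v (pderiv_dir 1 g) z + b * pderiv_dir v (pderiv_dir \<i> g) z"
    if "v \<in> {1, \<i>}" for v a b
    using partial_deriv_lincomb[OF assms(1) sm, of "[v]" z a b] that assms(2) by auto
  have "pderiv_dir 1 (pderiv_dir \<i> g) z = pderiv_dir \<i> (pderiv_dir 1 g) z"
  proof (rule pderiv_dir_commute[OF assms(1,2)])
    have *: "partial_deriv \<alpha> g differentiable (at w)" if "w \<in> \<Omega>" "\<alpha> \<in> lists {1, \<i>}" for w \<alpha>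
      using assms(3) that by (auto simp: smooth_on_def)
    show "g differentiable (at w)" if "w \<in> \<Omega>" for w using *[of w "[]"] that by simp
    show "pderiv_dir 1 g differentiable (at z)" "pderiv_dir \<i> g differentiable (at z)"
      using *[of z "[1]"] *[of z "[\<i>]"] assms(2) by auto
  qed
  then show ?thesis
    unfolding dbar_lincomb[of "dz g"] dz_lincomb[of "dbar g"] unfolding dz_lincomb dbar_lincomb
    by (subst (1 2 3 4) D) (auto simp: field_simps)
qed

text \<open>
  Nullity of \<open>dbar u\<close> includes all its derivatives, and \<open>dbar\<close> commutes with \<open>dz\<close>.
\<close>

lemma asymp_holomorphic_dz:
  assumes "open \<Omega>" "asymp_holomorphic \<Omega> u"
  shows "asymp_holomorphic \<Omega> (\<lambda>\<epsilon>. dz (u \<epsilon>))"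
  unfolding asymp_holomorphic_def
proof
  have u: "u \<in> colombeau_moderate \<Omega>" using assms by (simp add: asymp_holomorphic_def)
  show "(\<lambda>\<epsilon>. dz (u \<epsilon>)) \<in> colombeau_moderate \<Omega>"
    using gfun_deriv_class(2)[OF assms(1) u, of 1] by simp
  have "(\<lambda>\<epsilon>. dz (dbar (u \<epsilon>))) \<in> colombeau_null \<Omega>"
    using assms by (intro colombeau_null_dz) (auto simp: asymp_holomorphic_def)
  then show "(\<lambda>\<epsilon>. dbar (dz (u \<epsilon>))) \<in> colombeau_null \<Omega>"
    by (rule colombeau_null_cong[OF assms(1)])
       (simp add: dbar_dz_commute[OF assms(1)] colombeau_moderate_smooth[OF u])
qed

lemma asymp_holomorphic_dz_funpow:
  assumes "open \<Omega>" "asymp_holomorphic \<Omega> u"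
  shows "asymp_holomorphic \<Omega> (\<lambda>\<epsilon>. (dz ^^ n) (u \<epsilon>))"
  by (induction n) (use assms asymp_holomorphic_dz in auto)

lemma smooth_on_differentiable: "smooth_on \<Omega> g \<Longrightarrow> w \<in> \<Omega> \<Longrightarrow> g differentiable (at w)"
  unfolding smooth_on_def by (metis foldr.simps(1) id_apply lists.Nil)

lemma smooth_on_continuous_on: "smooth_on \<Omega> g \<Longrightarrow> S \<subseteq> \<Omega> \<Longrightarrow> continuous_on S g"
  by (intro continuous_at_imp_continuous_on ballI differentiable_imp_continuous_within)
     (auto dest: smooth_on_differentiable)

lemma asymp_holomorphic_smooth:
  assumes "asymp_holomorphic \<Omega> u" "\<epsilon> \<in> {0<..1}"
  shows "smooth_on \<Omega> (u \<epsilon>)" "smooth_on \<Omega> (dbar (u \<epsilon>))"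
  using assms by (auto simp: asymp_holomorphic_def colombeau_moderate_smooth dest: colombeau_null_smooth)

text \<open>
  The Cauchy estimate loses a constant but no power of \<open>\<epsilon>\<close>: the radius \<open>r\<close> is independent of \<open>\<epsilon>\<close>, and
  the null error terms are \<open>O(\<epsilon>\<^sup>p)\<close> for every \<open>p\<close>.
\<close>

lemma bigo_on_dz:
  assumes "open \<Omega>" "asymp_holomorphic \<Omega> u" "compact K" "0 < r" "(\<Union>x\<in>K. cball x r) \<subseteq> \<Omega>"
    and "bigo_on (\<lambda>_. \<Union>x\<in>K. cball x r) u p"
  shows "bigo_on (\<lambda>_. K) (\<lambda>\<epsilon>. dz (u \<epsilon>)) p"
proof -
  define L where "L = (\<Union>x\<in>K. cball x r)"
  have L: "compact L" "L \<subseteq> \<Omega>"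
    unfolding L_def using assms by (auto intro!: compact_minkowski_sum_cball)
  note u = assms(2) and du = asymp_holomorphic_dz[OF assms(1,2)]
  obtain C where C: "C \<ge> 0" "\<forall>\<^sub>F \<epsilon> in at_right 0. \<forall>w\<in>L. cmod (u \<epsilon> w) \<le> C * \<epsilon> powr p"
    using assms(6) unfolding L_def by (rule bigo_onE)
  have nulls: "bigo_on (\<lambda>_. L) (\<lambda>\<epsilon>. dbar (u \<epsilon>)) p" "bigo_on (\<lambda>_. L) (\<lambda>\<epsilon>. dbar (dz (u \<epsilon>))) p"
    using u du L by (auto simp: asymp_holomorphic_def intro: colombeau_null_bigo_on)
  obtain C1 where C1: "C1 \<ge> 0" "\<forall>\<^sub>F \<epsilon> in at_right 0. \<forall>w\<in>L. cmod (dbar (u \<epsilon>) w) \<le> C1 * \<epsilon> powr p"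
    using nulls(1) by (rule bigo_onE)
  obtain C2 where C2: "C2 \<ge> 0" "\<forall>\<^sub>F \<epsilon> in at_right 0. \<forall>w\<in>L. cmod (dbar (dz (u \<epsilon>)) w) \<le> C2 * \<epsilon> powr p"
    using nulls(2) by (rule bigo_onE)
  have "\<forall>\<^sub>F \<epsilon> in at_right 0. \<forall>w\<in>K. cmod (dz (u \<epsilon>) w) \<le> (C + (2 * r + 1) * r * (C1 + C2)) / r * \<epsilon> powr p"
    using ev01 C(2) C1(2) C2(2)
  proof eventually_elim
    case (elim \<epsilon>)
    then have \<epsilon>: "\<epsilon> \<in> {0<..1}" by simp
    show ?case
    proof
      fix z assume "z \<in> K"
      then have sub: "cball z r \<subseteq> L" "cball z r \<subseteq> \<Omega>" using L by (auto simp: L_def)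
      let ?\<eta> = "(C1 + C2) * \<epsilon> powr p"
      have le: "C1 * \<epsilon> powr p \<le> ?\<eta>" "C2 * \<epsilon> powr p \<le> ?\<eta>" using C1(1) C2(1) by (simp_all add: mult_right_mono)
      have "r * cmod (dz (u \<epsilon>) z) \<le> C * \<epsilon> powr p + (2 * r + 1) * r * ?\<eta>"
      proof (rule cauchy_estimate_dbar)
        show "cmod (dbar (u \<epsilon>) w) \<le> ?\<eta>" "cmod (dbar (dz (u \<epsilon>)) w) \<le> ?\<eta>" "cmod (u \<epsilon> w) \<le> C * \<epsilon> powr p"
          if "w \<in> cball z r" for w
          using elim that sub(1) le by (meson order_trans subsetD)+
        show "continuous_on (cball z r) (dz (dz (u \<epsilon>)))"
          by (rule smooth_on_continuous_on[OF asymp_holomorphic_smooth(1)[OF asymp_holomorphic_dz[OF assms(1) du] \<epsilon>] sub(2)])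
      qed (use asymp_holomorphic_smooth[OF u \<epsilon>] asymp_holomorphic_smooth[OF du \<epsilon>] sub(2) \<open>0 < r\<close>
           in \<open>auto intro: smooth_on_differentiable smooth_on_continuous_on\<close>)
      then show "cmod (dz (u \<epsilon>) z) \<le> (C + (2 * r + 1) * r * (C1 + C2)) / r * \<epsilon> powr p"
        using \<open>0 < r\<close> by (simp add: field_simps)
    qed
  qed
  then show ?thesis unfolding bigo_on_def by blast
qed

lemma cball_enlarge_twice:
  "(\<Union>x\<in>(\<Union>x\<in>K. cball x s). cball x t) \<subseteq> (\<Union>x\<in>K. cball x (s + t))" for K :: "'a::metric_space set"
proof
  fix y assume "y \<in> (\<Union>x\<in>(\<Union>x\<in>K. cball x s). cball x t)"
  then obtain x w where x: "x \<in> K" "dist x w \<le> s" "dist w y \<le> t" by auto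
  then have "dist x y \<le> s + t" using dist_triangle[of x y w] by linarith
  with x(1) show "y \<in> (\<Union>x\<in>K. cball x (s + t))" by auto
qed

text \<open>
  One exponent for all orders of differentiation, the property that distinguishes generalized
  holomorphic functions from arbitrary moderate nets. Each induction step halves the margin \<open>r\<close>; the
  constants grow with \<open>n\<close> without control, which is harmless because only finitely many orders are used
  for any given rate of decay.
\<close>

lemma bigo_on_dz_funpow:
  assumes "open \<Omega>" "asymp_holomorphic \<Omega> u" "compact K" "0 < r" "(\<Union>x\<in>K. cball x r) \<subseteq> \<Omega>"
    and "bigo_on (\<lambda>_. \<Union>x\<in>K. cball x r) u p"
  shows "bigo_on (\<lambda>_. K) (\<lambda>\<epsilon>. (dz ^^ n) (u \<epsilon>)) p"
  using assms(2,4-6)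
proof (induction n arbitrary: u r)
  case 0
  then show ?case by (auto intro!: bigo_on_subset[OF "0.prems"(4)] always_eventually)
next
  case (Suc n)
  define L where "L = (\<Union>x\<in>K. cball x (r/2))"
  have "compact L" unfolding L_def using assms(3) by (intro compact_minkowski_sum_cball)
  have LL: "(\<Union>x\<in>L. cball x (r/2)) \<subseteq> (\<Union>x\<in>K. cball x r)"
    using cball_enlarge_twice[of "r/2" "r/2" K] by (simp add: L_def)
  have "bigo_on (\<lambda>_. L) (\<lambda>\<epsilon>. dz (u \<epsilon>)) p"
    by (rule bigo_on_dz[OF assms(1) Suc.prems(1) \<open>compact L\<close>, of "r/2"])
       (use Suc.prems LL in \<open>auto intro!: bigo_on_subset[OF Suc.prems(4)] always_eventually\<close>)
  moreover have "L \<subseteq> \<Omega>"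
    using Suc.prems(2,3) unfolding L_def by force
  ultimately have "bigo_on (\<lambda>_. K) (\<lambda>\<epsilon>. (dz ^^ n) (dz (u \<epsilon>))) p"
    using Suc.prems(2) asymp_holomorphic_dz[OF assms(1) Suc.prems(1)]
    by (intro Suc.IH[of _ "r/2"]) (auto simp: L_def)
  then show ?case by (simp add: funpow_swap1)
qed

text \<open>
  On a disc of radius \<open>\<epsilon>\<^sup>a\<close> the mean value inequality gains the factor \<open>\<epsilon>\<^sup>a\<close> over the bound for
  \<open>dz u\<close>; the null derivative \<open>dbar u\<close> does not affect the rate.
\<close>

lemma bigo_on_increment:
  assumes "asymp_holomorphic \<Omega> u" "compact K" "K \<subseteq> \<Omega>"
    and L: "L = (\<lambda>\<epsilon>. if \<epsilon> \<in> S then cball (z \<epsilon>) (\<epsilon> powr a) else {})"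
    and LK: "\<forall>\<^sub>F \<epsilon> in at_right 0. L \<epsilon> \<subseteq> K"
    and dz: "bigo_on L (\<lambda>\<epsilon>. dz (u \<epsilon>)) p"
  shows "bigo_on L (\<lambda>\<epsilon> w. u \<epsilon> w - u \<epsilon> (z \<epsilon>)) (p + a)"
proof -
  obtain C where C: "C \<ge> 0" "\<forall>\<^sub>F \<epsilon> in at_right 0. \<forall>w\<in>L \<epsilon>. cmod (dz (u \<epsilon>) w) \<le> C * \<epsilon> powr p"
    using dz by (rule bigo_onE)
  have "bigo_on (\<lambda>_. K) (\<lambda>\<epsilon>. dbar (u \<epsilon>)) p"
    using assms(1-3) by (auto simp: asymp_holomorphic_def intro: colombeau_null_bigo_on)
  then obtain D where D: "D \<ge> 0" "\<forall>\<^sub>F \<epsilon> in at_right 0. \<forall>w\<in>K. cmod (dbar (u \<epsilon>) w) \<le> D * \<epsilon> powr p"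
    by (rule bigo_onE)
  have "\<forall>\<^sub>F \<epsilon> in at_right 0. \<forall>w\<in>L \<epsilon>. cmod (u \<epsilon> w - u \<epsilon> (z \<epsilon>)) \<le> (C + D) * \<epsilon> powr (p + a)"
    using ev01 C(2) D(2) LK
  proof eventually_elim
    case (elim \<epsilon>)
    show ?case
    proof
      fix w assume w: "w \<in> L \<epsilon>"
      then have Lb: "L \<epsilon> = cball (z \<epsilon>) (\<epsilon> powr a)" by (simp add: L split: if_splits)
      have "cmod (u \<epsilon> w - u \<epsilon> (z \<epsilon>)) \<le> (C + D) * \<epsilon> powr p * cmod (w - z \<epsilon>)"
      proof (rule differentiable_bound[of "L \<epsilon>"])
        fix x assume x: "x \<in> L \<epsilon>"
        then have "u \<epsilon> differentiable (at x)"
          using elim assms(1,3) by (intro smooth_on_differentiable[of \<Omega>] asymp_holomorphic_smooth) auto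
        then show "(u \<epsilon> has_derivative (\<lambda>v. v * dz (u \<epsilon>) x + cnj v * dbar (u \<epsilon>) x)) (at x within L \<epsilon>)"
          by (rule has_derivative_at_withinI[OF has_derivative_wirtinger])
        show "onorm (\<lambda>v. v * dz (u \<epsilon>) x + cnj v * dbar (u \<epsilon>) x) \<le> (C + D) * \<epsilon> powr p"
        proof (rule onorm_le)
          fix v
          have "cmod (v * dz (u \<epsilon>) x + cnj v * dbar (u \<epsilon>) x) \<le> cmod v * cmod (dz (u \<epsilon>) x) + cmod v * cmod (dbar (u \<epsilon>) x)"
            by (rule order_trans[OF norm_triangle_ineq]) (simp add: norm_mult)
          also have "\<dots> \<le> cmod v * (C * \<epsilon> powr p) + cmod v * (D * \<epsilon> powr p)"
            using elim x by (intro add_mono mult_left_mono) auto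
          finally show "cmod (v * dz (u \<epsilon>) x + cnj v * dbar (u \<epsilon>) x) \<le> (C + D) * \<epsilon> powr p * cmod v"
            by (simp add: algebra_simps)
        qed
      qed (use w Lb in \<open>auto simp: Lb\<close>)
      also have "\<dots> \<le> (C + D) * \<epsilon> powr p * \<epsilon> powr a"
        using w Lb C(1) D(1) by (intro mult_left_mono) (auto simp: dist_norm norm_minus_commute)
      finally show "cmod (u \<epsilon> w - u \<epsilon> (z \<epsilon>)) \<le> (C + D) * \<epsilon> powr (p + a)"
        by (simp add: powr_add mult.assoc)
    qed
  qed
  then show ?thesis unfolding bigo_on_def by blast
qed

text \<open>
  On the small discs, a bound for the derivative of order \<open>n + 1\<close> yields one for the derivative of order
  \<open>n\<close> that is better by \<open>\<epsilon>\<^sup>a\<close>, since the value at the centre is null. All orders start with the same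
  exponent \<open>p\<close>, so after \<open>j\<close> rounds they all have exponent \<open>p + j a\<close>; this replaces Taylor's formula.
\<close>

lemma bigo_on_increment_of_null_derivatives:
  assumes "open \<Omega>" and u: "asymp_holomorphic \<Omega> u" and "compact K" "K \<subseteq> \<Omega>"
    and S: "\<forall>\<^sub>F \<epsilon> in at_right 0. \<epsilon> \<in> S \<longrightarrow> z \<epsilon> \<in> K" and "a > 0"
    and null: "\<And>n. n \<ge> 1 \<Longrightarrow> null (\<lambda>\<epsilon>. if \<epsilon> \<in> S then (dz ^^ n) (u \<epsilon>) (z \<epsilon>) else 0)"
  shows "bigo_on (\<lambda>\<epsilon>. if \<epsilon> \<in> S then cball (z \<epsilon>) (\<epsilon> powr a) else {}) (\<lambda>\<epsilon> w. u \<epsilon> w - u \<epsilon> (z \<epsilon>)) q"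
proof -
  obtain r where r: "r > 0" "(\<Union>x\<in>K. cball x r) \<subseteq> \<Omega>"
    using compact_subset_open_imp_cball_epsilon_subset[OF \<open>compact K\<close> assms(1) \<open>K \<subseteq> \<Omega>\<close>] by blast
  \<comment> \<open>\<open>K1\<close> contains the small discs, and \<open>K2\<close> leaves room around \<open>K1\<close> for the Cauchy estimates\<close>
  define K1 where "K1 = (\<Union>x\<in>K. cball x (r/2))"
  define K2 where "K2 = (\<Union>x\<in>K1. cball x (r/2))"
  have "compact K1" unfolding K1_def using \<open>compact K\<close> by (rule compact_minkowski_sum_cball)
  then have "compact K2" unfolding K2_def by (rule compact_minkowski_sum_cball)
  have "K2 \<subseteq> (\<Union>x\<in>K. cball x r)"
    using cball_enlarge_twice[of "r/2" "r/2" K] by (simp add: K1_def K2_def)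
  then have "K2 \<subseteq> \<Omega>" using r by blast
  have "K1 \<subseteq> K2" using r unfolding K2_def by force
  then have "K1 \<subseteq> \<Omega>" using \<open>K2 \<subseteq> \<Omega>\<close> by blast
  define L where "L = (\<lambda>\<epsilon>. if \<epsilon> \<in> S then cball (z \<epsilon>) (\<epsilon> powr a) else {})"
  have "((\<lambda>\<epsilon>::real. \<epsilon> powr a) \<longlongrightarrow> 0 powr a) (at_right 0)"
    using \<open>a > 0\<close> ev01 by (intro tendsto_powr' tendsto_ident_at tendsto_const) (auto elim: eventually_mono)
  then have "\<forall>\<^sub>F \<epsilon> in at_right (0::real). \<epsilon> powr a < r / 2"
    using r \<open>a > 0\<close> by (intro order_tendstoD(2)) auto
  then have LK1: "\<forall>\<^sub>F \<epsilon> in at_right 0. L \<epsilon> \<subseteq> K1"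
    using S by eventually_elim (auto simp: L_def K1_def)
  obtain p where p: "bigo_on (\<lambda>_. K2) u p"
    using colombeau_moderate_bigo_on[OF _ \<open>compact K2\<close> \<open>K2 \<subseteq> \<Omega>\<close>] u by (auto simp: asymp_holomorphic_def)
  have bound: "bigo_on L (\<lambda>\<epsilon>. (dz ^^ n) (u \<epsilon>)) p" for n
  proof -
    have "bigo_on (\<lambda>_. K1) (\<lambda>\<epsilon>. (dz ^^ n) (u \<epsilon>)) p"
      by (rule bigo_on_dz_funpow[OF assms(1) u \<open>compact K1\<close>, of "r/2"])
         (use r p \<open>K2 \<subseteq> \<Omega>\<close> in \<open>auto simp: K2_def\<close>)
    then show ?thesis using LK1 by (rule bigo_on_subset)
  qed
  have incr: "bigo_on L (\<lambda>\<epsilon> w. (dz ^^ n) (u \<epsilon>) w - (dz ^^ n) (u \<epsilon>) (z \<epsilon>)) (s + a)"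
    if "bigo_on L (\<lambda>\<epsilon>. (dz ^^ Suc n) (u \<epsilon>)) s" for n s
    by (rule bigo_on_increment[OF asymp_holomorphic_dz_funpow[OF assms(1) u] \<open>compact K1\<close> \<open>K1 \<subseteq> \<Omega>\<close> L_def LK1])
       (use that in simp)
  have gain: "bigo_on L (\<lambda>\<epsilon>. (dz ^^ Suc n) (u \<epsilon>)) (p + real j * a)" for n j
  proof (induction j arbitrary: n)
    case 0
    show ?case using bound[of "Suc n"] by simp
  next
    case (Suc j)
    have 1: "bigo_on L (\<lambda>\<epsilon> w. (dz ^^ Suc n) (u \<epsilon>) w - (dz ^^ Suc n) (u \<epsilon>) (z \<epsilon>)) (p + real (Suc j) * a)"
      using incr[OF Suc.IH[of "Suc n"]] by (simp add: algebra_simps)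
    have "\<forall>\<^sub>F \<epsilon> in at_right 0. \<forall>w\<in>L \<epsilon>. cmod ((dz ^^ Suc n) (u \<epsilon>) (z \<epsilon>)) \<le> 1 * \<epsilon> powr (p + real (Suc j) * a)"
      using null_imp_eventually_le[OF null[of "Suc n"], of "p + real (Suc j) * a"]
      by (auto elim!: eventually_mono simp: L_def)
    then have "bigo_on L (\<lambda>\<epsilon> w. (dz ^^ Suc n) (u \<epsilon>) (z \<epsilon>)) (p + real (Suc j) * a)"
      unfolding bigo_on_def by blast
    from bigo_on_add[OF 1 this] show ?case by simp
  qed
  obtain j where j: "(q - p) / a \<le> real j" using real_arch_simple by blast
  have "bigo_on L (\<lambda>\<epsilon> w. (dz ^^ 0) (u \<epsilon>) w - (dz ^^ 0) (u \<epsilon>) (z \<epsilon>)) (p + real j * a + a)"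
    by (rule incr[OF gain])
  moreover have "q \<le> p + real j * a + a" using j \<open>a > 0\<close> by (simp add: field_simps)
  ultimately show ?thesis unfolding L_def by (auto intro: bigo_on_mono)
qed

section \<open>Generalized numbers and their idempotents\<close>

lemma abs_gcomplex_eq_iff:
  assumes "moderate x" "moderate y"
  shows "abs_gcomplex x = abs_gcomplex y \<longleftrightarrow> null (\<lambda>\<epsilon>. x \<epsilon> - y \<epsilon>)"
  using Quotient_rel[OF Quotient_gcomplex, of x y] assms by (auto simp: gc_rel_def null_def)

lemma abs_gcomplex_eq_0_iff: "moderate x \<Longrightarrow> abs_gcomplex x = 0 \<longleftrightarrow> null x"
  using abs_gcomplex_eq_iff[of x "\<lambda>_. 0"] by (simp add: zero_gcomplex_def moderate_def exI[of _ 0])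

lemma gcomplex_representative:
  obtains x where "moderate x" "q = abs_gcomplex x"
proof
  show "q = abs_gcomplex (rep_gcomplex q)"
    by (rule Quotient_abs_rep[OF Quotient_gcomplex, symmetric])
  show "moderate (rep_gcomplex q)"
    using Quotient_rep_reflp[OF Quotient_gcomplex, of q] by (simp add: gc_rel_def)
qed

lemma abs_gcomplex_times:
  "moderate x \<Longrightarrow> moderate y \<Longrightarrow> abs_gcomplex x * abs_gcomplex y = abs_gcomplex (\<lambda>\<epsilon>. x \<epsilon> * y \<epsilon>)"
  by (intro times_gcomplex.abs_eq gc_rel_refl)

lemma abs_gcomplex_diff:
  assumes "moderate x" "moderate y"
  shows "abs_gcomplex x - abs_gcomplex y = abs_gcomplex (\<lambda>\<epsilon>. x \<epsilon> - y \<epsilon>)"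
  using plus_gcomplex.abs_eq[of x "\<lambda>\<epsilon>. - y \<epsilon>"] uminus_gcomplex.abs_eq[of y] assms
  by (simp add: minus_gcomplex_def gc_rel_refl moderate_uminus)

lemma sharp_norm_le:
  assumes "moderate x" "decays x b"
  shows "sharp_norm (abs_gcomplex x) \<le> exp (- b)"
proof -
  have v: "ereal b \<le> valuation (abs_gcomplex x)"
    using assms by (auto simp: valuation.abs_eq gc_rel_refl intro!: Sup_upper)
  then show ?thesis
    by (cases "valuation (abs_gcomplex x)") (auto simp: sharp_norm_def)
qed

definition restriction_idempotent :: "real set \<Rightarrow> gcomplex" where
  "restriction_idempotent S = abs_gcomplex (\<lambda>\<epsilon>. if \<epsilon> \<in> S then 1 else 0)"

lemma moderate_indicator: "moderate (\<lambda>\<epsilon>. if \<epsilon> \<in> S then 1 else 0)"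
proof -
  have "decays (\<lambda>\<epsilon>. if \<epsilon> \<in> S then 1 else 0) (-1)"
    by (rule decays_le[OF _ decays_one]) auto
  then show ?thesis by (auto simp: moderate_def)
qed

text \<open>
  A net that is not null fails to be \<open>o(\<epsilon>\<^sup>b)\<close> for some \<open>b\<close>. This means \<open>|x \<epsilon>| \<ge> c \<epsilon>\<^sup>b\<close> for parameters
  arbitrarily close to \<open>0\<close>, and there \<open>1 / x\<close> is moderate.
\<close>

lemma nonzero_invertible_on:
  assumes "r \<noteq> 0"
  obtains S s where "\<exists>\<^sub>F \<epsilon> in at_right 0. \<epsilon> \<in> S" "r * s = restriction_idempotent S"
proof -
  obtain x where x: "moderate x" "r = abs_gcomplex x" by (rule gcomplex_representative)
  then have "\<not> null x" using assms abs_gcomplex_eq_0_iff by blast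
  then obtain b where "\<not> decays x b" by (auto simp: null_def)
  then obtain c where c: "c > 0" "\<not> (\<forall>\<^sub>F \<epsilon> in at_right 0. cmod (x \<epsilon>) / \<epsilon> powr b < c)"
    by (auto simp: decays_def tendsto_iff dist_real_def)
  define S where "S = {\<epsilon>. c * \<epsilon> powr b \<le> cmod (x \<epsilon>)}"
  define y where "y = (\<lambda>\<epsilon>. if \<epsilon> \<in> S then 1 / x \<epsilon> else 0)"
  have freq: "\<exists>\<^sub>F \<epsilon> in at_right 0. \<epsilon> \<in> S"
    unfolding frequently_def
  proof
    assume "\<forall>\<^sub>F \<epsilon> in at_right 0. \<not> \<epsilon> \<in> S"
    with ev01 have "\<forall>\<^sub>F \<epsilon> in at_right 0. cmod (x \<epsilon>) / \<epsilon> powr b < c"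
      by eventually_elim (simp add: S_def pos_divide_less_eq)
    with c(2) show False by blast
  qed
  have "\<forall>\<^sub>F \<epsilon> in at_right 0. cmod (y \<epsilon>) \<le> 1 / c * \<epsilon> powr (- b)"
    using ev01
  proof eventually_elim
    case (elim \<epsilon>)
    have "0 < c * \<epsilon> powr b" using c(1) elim by simp
    then have "1 / cmod (x \<epsilon>) \<le> 1 / (c * \<epsilon> powr b)" if "\<epsilon> \<in> S"
      using that by (intro frac_le) (auto simp: S_def)
    then show ?case using c(1) by (auto simp: y_def norm_divide norm_inverse powr_minus divide_inverse)
  qed
  then have "decays y (- b - 1)" by (rule decays_bound) simp
  then have y: "moderate y" by (auto simp: moderate_def)
  have "null (\<lambda>\<epsilon>. x \<epsilon> * y \<epsilon> - (if \<epsilon> \<in> S then 1 else 0))"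
    unfolding null_def
  proof
    fix d
    have "\<forall>\<^sub>F \<epsilon> in at_right 0. cmod (x \<epsilon> * y \<epsilon> - (if \<epsilon> \<in> S then 1 else 0)) \<le> cmod 0"
      using ev01
    proof eventually_elim
      case (elim \<epsilon>)
      then have "0 < c * \<epsilon> powr b" using c(1) by simp
      then have "x \<epsilon> \<noteq> 0" if "\<epsilon> \<in> S" using that by (auto simp: S_def)
      then show ?case by (simp add: y_def)
    qed
    then show "decays (\<lambda>\<epsilon>. x \<epsilon> * y \<epsilon> - (if \<epsilon> \<in> S then 1 else 0)) d" by (rule decays_le) simp
  qed
  then have "r * abs_gcomplex y = restriction_idempotent S"
    unfolding restriction_idempotent_def x(2) abs_gcomplex_times[OF x(1) y]
    by (simp add: abs_gcomplex_eq_iff moderate_mult x(1) y moderate_indicator)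
  with freq show ?thesis by (rule that)
qed

text \<open>
  Elements \<open>x\<close> of \<open>J\<close> are themselves candidates for the factor \<open>r\<close> in the definition of density, so they
  are annihilated by \<open>r1\<close> and hence by the idempotent that \<open>r1\<close> divides.
\<close>

lemma annihilated_if_not_dense:
  assumes "is_ideal J" "\<not> dense_ideal J"
  obtains S where "\<exists>\<^sub>F \<epsilon> in at_right 0. \<epsilon> \<in> S" "\<And>x. x \<in> J \<Longrightarrow> x * restriction_idempotent S = 0"
proof -
  obtain r1 r2 where r: "r1 \<noteq> 0" "\<And>r. r1 * r \<noteq> 0 \<Longrightarrow> r2 * r \<notin> J"
    using assms by (auto simp: dense_ideal_def)
  obtain S s where S: "\<exists>\<^sub>F \<epsilon> in at_right 0. \<epsilon> \<in> S" "r1 * s = restriction_idempotent S"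
    using r(1) by (rule nonzero_invertible_on)
  have "x * restriction_idempotent S = 0" if "x \<in> J" for x
  proof -
    have "r2 * x \<in> J" using assms(1) that by (rule ring_module.subspace_scale)
    then have "r1 * x = 0" using r(2) by blast
    then show ?thesis by (metis S(2) mult.assoc mult.commute mult_zero_left)
  qed
  with S(1) show ?thesis by (rule that)
qed

section \<open>The fibre accumulates where the derivatives are annihilated\<close>

text \<open>
  The point \<open>z\<close> is moved by \<open>\<epsilon>\<^sup>a\<close> along \<open>S\<close>: far enough to change its class, because \<open>\<epsilon>\<^sup>a\<close> is not null
  along \<open>S\<close>, but too little to change the class of the value of \<open>u\<close>.
\<close>

lemma accumulation_if_null_derivatives:
  assumes "open \<Omega>" and u: "asymp_holomorphic \<Omega> u" and z: "compactly_supported \<Omega> z"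
    and S: "\<exists>\<^sub>F \<epsilon> in at_right 0. \<epsilon> \<in> S"
    and null: "\<And>n. n \<ge> 1 \<Longrightarrow> null (\<lambda>\<epsilon>. if \<epsilon> \<in> S then (dz ^^ n) (u \<epsilon>) (z \<epsilon>) else 0)"
    and "e > 0"
  obtains w where "compactly_supported \<Omega> w" "abs_gcomplex w \<noteq> abs_gcomplex z"
    "dist (abs_gcomplex z) (abs_gcomplex w) < e"
    "gfun_eval \<Omega> (gfun_class \<Omega> u) (abs_gcomplex w) = gfun_eval \<Omega> (gfun_class \<Omega> u) (abs_gcomplex z)"
proof -
  have um: "u \<in> colombeau_moderate \<Omega>" using u by (simp add: asymp_holomorphic_def)
  \<comment> \<open>a displacement of size \<open>\<epsilon>\<^sup>a\<close> decays at every rate below \<open>a\<close>; the rate \<open>a - 1\<close> must beat \<open>e\<close>\<close>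
  define a where "a = max 1 (2 - ln e)"
  have "a \<ge> 1" by (simp add: a_def)
  have "exp (- (a - 1)) \<le> exp (ln e - 1)" by (simp add: a_def)
  also have "\<dots> < e" using \<open>e > 0\<close> by (simp add: exp_diff divide_less_eq)
  finally have exp_a: "exp (- (a - 1)) < e" .
  obtain K where K: "compact K" "K \<noteq> {}" "K \<subseteq> \<Omega>" "\<forall>\<^sub>F \<epsilon> in at_right 0. z \<epsilon> \<in> K"
    using z by (rule compactly_supported_obtain)
  obtain r where r: "r > 0" "(\<Union>x\<in>K. cball x r) \<subseteq> \<Omega>"
    using compact_subset_open_imp_cball_epsilon_subset[OF K(1) assms(1) K(3)] by blast
  \<comment> \<open>the two extra conditions keep \<open>w\<close> inside \<open>\<Omega>\<close> for every \<open>\<epsilon>\<close>; they hold for small \<open>\<epsilon>\<close>\<close>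
  define w where "w = (\<lambda>\<epsilon>. if \<epsilon> \<in> S \<and> z \<epsilon> \<in> K \<and> \<epsilon> powr a \<le> r then z \<epsilon> + of_real (\<epsilon> powr a) else z \<epsilon>)"
  have wz: "cmod (w \<epsilon> - z \<epsilon>) \<le> \<epsilon> powr a" for \<epsilon> by (simp add: w_def)
  have inK: "w \<epsilon> \<in> (\<Union>x\<in>K. cball x r)" if "z \<epsilon> \<in> K" for \<epsilon>
    using that r(1) by (auto simp: w_def dist_norm intro!: bexI[of _ "z \<epsilon>"])
  have w: "compactly_supported \<Omega> w"
    unfolding compactly_supported_def
  proof (intro conjI ballI exI[of _ "\<Union>x\<in>K. cball x r"])
    show "w \<epsilon> \<in> \<Omega>" if "\<epsilon> \<in> {0<..1}" for \<epsilon>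
    proof (cases "z \<epsilon> \<in> K")
      case True
      then show ?thesis using inK r(2) by blast
    next
      case False
      then show ?thesis using z that by (simp add: w_def compactly_supported_def)
    qed
    show "compact (\<Union>x\<in>K. cball x r)" using K(1) by (rule compact_minkowski_sum_cball)
    show "\<forall>\<^sub>F \<epsilon> in at_right 0. w \<epsilon> \<in> (\<Union>x\<in>K. cball x r)"
      using K(4) by eventually_elim (rule inK)
  qed (rule r(2))
  note mod = compactly_supported_moderate[OF w] compactly_supported_moderate[OF z]
  have "((\<lambda>\<epsilon>::real. \<epsilon> powr a) \<longlongrightarrow> 0 powr a) (at_right 0)"
    using \<open>a \<ge> 1\<close> ev01 by (intro tendsto_powr' tendsto_ident_at tendsto_const) (auto elim: eventually_mono)
  then have small: "\<forall>\<^sub>F \<epsilon> in at_right (0::real). \<epsilon> powr a < r"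
    using r \<open>a \<ge> 1\<close> by (intro order_tendstoD(2)) auto
  have "abs_gcomplex w \<noteq> abs_gcomplex z"
  proof
    assume "abs_gcomplex w = abs_gcomplex z"
    then have "null (\<lambda>\<epsilon>. w \<epsilon> - z \<epsilon>)" using abs_gcomplex_eq_iff[OF mod] by blast
    then have "\<forall>\<^sub>F \<epsilon> in at_right 0. cmod (w \<epsilon> - z \<epsilon>) \<le> \<epsilon> powr (a + 1)"
      by (rule null_imp_eventually_le)
    moreover have "\<forall>\<^sub>F \<epsilon> in at_right (0::real). 0 < \<epsilon> \<and> \<epsilon> < 1"
      by (rule eventually_at_rightI[of 0 1]) auto
    ultimately have "\<forall>\<^sub>F \<epsilon> in at_right 0. \<epsilon> \<notin> S"
      using K(4) small
    proof eventually_elim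
      case (elim \<epsilon>)
      show ?case
      proof
        assume "\<epsilon> \<in> S"
        then have "\<epsilon> powr a \<le> \<epsilon> powr (a + 1)" using elim by (simp add: w_def)
        moreover have "\<epsilon> powr (a + 1) < \<epsilon> powr a" using elim by (intro powr_less_mono') auto
        ultimately show False by simp
      qed
    qed
    with S show False by (simp add: frequently_def)
  qed
  moreover have "dist (abs_gcomplex z) (abs_gcomplex w) < e"
  proof -
    have "\<forall>\<^sub>F \<epsilon> in at_right 0. cmod (z \<epsilon> - w \<epsilon>) \<le> 1 * \<epsilon> powr a"
      using wz by (simp add: norm_minus_commute)
    then have d: "decays (\<lambda>\<epsilon>. z \<epsilon> - w \<epsilon>) (a - 1)" by (rule decays_bound) simp
    then have "moderate (\<lambda>\<epsilon>. z \<epsilon> - w \<epsilon>)" by (auto simp: moderate_def)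
    from sharp_norm_le[OF this d] exp_a show ?thesis
      by (simp add: dist_gcomplex_def abs_gcomplex_diff mod)
  qed
  moreover have "null (\<lambda>\<epsilon>. u \<epsilon> (w \<epsilon>) - u \<epsilon> (z \<epsilon>))"
    unfolding null_def
  proof
    fix q
    let ?L = "\<lambda>\<epsilon>. if \<epsilon> \<in> S then cball (z \<epsilon>) (\<epsilon> powr a) else {}"
    have "bigo_on ?L (\<lambda>\<epsilon> w. u \<epsilon> w - u \<epsilon> (z \<epsilon>)) (q + 1)"
    proof (rule bigo_on_increment_of_null_derivatives[OF assms(1) u K(1,3) _ _ null])
      show "\<forall>\<^sub>F \<epsilon> in at_right 0. \<epsilon> \<in> S \<longrightarrow> z \<epsilon> \<in> K" using K(4) by eventually_elim simp
    qed (use \<open>a \<ge> 1\<close> in auto)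
    then obtain C where C: "C \<ge> 0"
      "\<forall>\<^sub>F \<epsilon> in at_right 0. \<forall>w\<in>?L \<epsilon>. cmod (u \<epsilon> w - u \<epsilon> (z \<epsilon>)) \<le> C * \<epsilon> powr (q + 1)"
      by (rule bigo_onE)
    from C(2) have "\<forall>\<^sub>F \<epsilon> in at_right 0. cmod (u \<epsilon> (w \<epsilon>) - u \<epsilon> (z \<epsilon>)) \<le> C * \<epsilon> powr (q + 1)"
    proof eventually_elim
      case (elim \<epsilon>)
      show ?case
      proof (cases "\<epsilon> \<in> S")
        case True
        then have "w \<epsilon> \<in> ?L \<epsilon>" using wz[of \<epsilon>] by (simp add: dist_norm norm_minus_commute)
        then show ?thesis using elim by blast
      next
        case False
        then show ?thesis using C(1) by (simp add: w_def)
      qed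
    qed
    then show "decays (\<lambda>\<epsilon>. u \<epsilon> (w \<epsilon>) - u \<epsilon> (z \<epsilon>)) q" by (rule decays_bound) simp
  qed
  then have "gfun_eval \<Omega> (gfun_class \<Omega> u) (abs_gcomplex w) = gfun_eval \<Omega> (gfun_class \<Omega> u) (abs_gcomplex z)"
    using moderate_point_value[OF um w] moderate_point_value[OF um z]
    by (simp add: gfun_eval_class[OF assms(1) um] w z abs_gcomplex_eq_iff)
  ultimately show ?thesis using w that by blast
qed

lemma gen_holomorphic_representative:
  assumes "open \<Omega>" "f \<in> gen_holomorphic \<Omega>"
  obtains u where "asymp_holomorphic \<Omega> u" "f = gfun_class \<Omega> u"
proof -
  obtain u where u: "u \<in> colombeau_moderate \<Omega>" "f = gfun_class \<Omega> u"
    using assms(2) by (auto simp: gen_holomorphic_def colombeau_def gfun_class_def elim: quotientE)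
  have "gfun_class \<Omega> (\<lambda>\<epsilon>. dbar (u \<epsilon>)) = gfun_class \<Omega> (\<lambda>\<epsilon> z. 0)"
    using assms(2) by (simp add: gen_holomorphic_def u(2) gfun_lift_dbar[OF assms(1) u(1)])
  moreover have "((\<lambda>\<epsilon> z. 0), (\<lambda>\<epsilon> z. 0)) \<in> colombeau_rel \<Omega>"
    using colombeau_moderate_lincomb[OF assms(1) u(1) u(1), of 0 0] colombeau_null_zero[OF assms(1)]
    by (simp add: colombeau_rel_def)
  ultimately have "((\<lambda>\<epsilon>. dbar (u \<epsilon>)), (\<lambda>\<epsilon> z. 0)) \<in> colombeau_rel \<Omega>"
    unfolding gfun_class_def by blast
  then have "asymp_holomorphic \<Omega> u"
    using u(1) by (simp add: colombeau_rel_def asymp_holomorphic_def)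
  then show ?thesis using u(2) by (rule that)
qed

section \<open>Density of the coefficient ideals\<close>

theorem theorem5p4:
  fixes \<Omega> :: "complex set" and f :: gfun
  assumes "open \<Omega>" and "\<Omega> \<noteq> {}"
    and "f \<in> gen_holomorphic \<Omega>"
    and "satisfies_identity_theorem \<Omega> f"
  shows "\<forall>z0 \<in> gen_points \<Omega>. dense_ideal (coeff_ideal \<Omega> f z0)"
proof (rule ballI, rule ccontr)
  fix z0 assume z0: "z0 \<in> gen_points \<Omega>" and not_dense: "\<not> dense_ideal (coeff_ideal \<Omega> f z0)"
  obtain u where u: "asymp_holomorphic \<Omega> u" and f: "f = gfun_class \<Omega> u"
    using assms(1,3) by (rule gen_holomorphic_representative)
  have um: "u \<in> colombeau_moderate \<Omega>" using u by (simp add: asymp_holomorphic_def)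
  obtain z where z: "compactly_supported \<Omega> z" and z0_eq: "z0 = abs_gcomplex z"
    using z0 by (auto simp: gen_points_def)
  have "is_ideal (coeff_ideal \<Omega> f z0)" unfolding coeff_ideal_def by (rule ring_module.subspace_span)
  then obtain S where S: "\<exists>\<^sub>F \<epsilon> in at_right 0. \<epsilon> \<in> S"
    "\<And>x. x \<in> coeff_ideal \<Omega> f z0 \<Longrightarrow> x * restriction_idempotent S = 0"
    using not_dense by (rule annihilated_if_not_dense) blast
  have null: "null (\<lambda>\<epsilon>. if \<epsilon> \<in> S then (dz ^^ n) (u \<epsilon>) (z \<epsilon>) else 0)" if "n \<ge> 1" for n
  proof -
    note deriv = gfun_deriv_class[OF assms(1) um, of n]
    have mod: "moderate (\<lambda>\<epsilon>. (dz ^^ n) (u \<epsilon>) (z \<epsilon>))" by (rule moderate_point_value[OF deriv(2) z])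
    have "gfun_eval \<Omega> (gfun_deriv \<Omega> n f) z0 \<in> coeff_ideal \<Omega> f z0"
      unfolding coeff_ideal_def using that by (intro ring_module.span_base) blast
    then have "abs_gcomplex (\<lambda>\<epsilon>. (dz ^^ n) (u \<epsilon>) (z \<epsilon>)) * restriction_idempotent S = 0"
      using S(2) by (simp add: f z0_eq deriv(1) gfun_eval_class[OF assms(1) deriv(2) z])
    then have "null (\<lambda>\<epsilon>. (dz ^^ n) (u \<epsilon>) (z \<epsilon>) * (if \<epsilon> \<in> S then 1 else 0))"
      unfolding restriction_idempotent_def
      by (simp only: abs_gcomplex_times[OF mod moderate_indicator]
          abs_gcomplex_eq_0_iff[OF moderate_mult[OF mod moderate_indicator]])
    then show ?thesis by (simp add: if_distrib cong: if_cong)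
  qed
  have "z0 \<in> top_of_set (gen_points \<Omega>) derived_set_of
      {z \<in> gen_points \<Omega>. gfun_eval \<Omega> f z = gfun_eval \<Omega> f z0}"
    unfolding derived_set_of_def topspace_euclidean_subtopology
  proof (intro CollectI conjI allI impI z0)
    fix T assume T: "z0 \<in> T \<and> openin (top_of_set (gen_points \<Omega>)) T"
    then obtain U where "open U" "T = gen_points \<Omega> \<inter> U" by (auto simp: openin_open)
    moreover from this T obtain e where "e > 0" "ball z0 e \<subseteq> U" by (auto elim: openE)
    ultimately have e: "e > 0" "ball z0 e \<inter> gen_points \<Omega> \<subseteq> T" by auto
    obtain w where w: "compactly_supported \<Omega> w" "abs_gcomplex w \<noteq> abs_gcomplex z"
      "dist (abs_gcomplex z) (abs_gcomplex w) < e"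
      "gfun_eval \<Omega> f (abs_gcomplex w) = gfun_eval \<Omega> f (abs_gcomplex z)"
      unfolding f using accumulation_if_null_derivatives[OF assms(1) u z S(1) null e(1)] .
    then have "abs_gcomplex w \<in> gen_points \<Omega>" by (auto simp: gen_points_def)
    with w e(2) show "\<exists>y. y \<noteq> z0 \<and> y \<in> {z \<in> gen_points \<Omega>. gfun_eval \<Omega> f z = gfun_eval \<Omega> f z0} \<and> y \<in> T"
      by (intro exI[of _ "abs_gcomplex w"]) (auto simp: z0_eq)
  qed
  with assms(4) z0 show False by (auto simp: satisfies_identity_theorem_def)
qed

end
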